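(* There exists a constant $C=C(\|b\|_\infty,\|V\|_\infty)\ge 0$ (depending on $b$ and $V$ only through $\|b\|_\infty$ and $\|V\|_\infty$, the dimension $d$ and the exponent $\alpha$ being fixed) such that for any classical solution $(u,m)$ of $$\begin{cases} u-\Delta u+\dfrac{|Du|^2}{2m^\alpha}+b(x)\cdot Du=V(x,m) & \text{in }\mathbb{T}^d,\\[1ex] m-\Delta m-\operatorname{div}\big(m^{1-\alpha}Du\big)-\operatorname{div}(mb)=1 & \text{in }\mathbb{T}^d,\end{cases}$$ we have $$\left\|\frac1m\right\|_{L^\infty(\mathbb{T}^d)}\le C.$$
   Context: $\mathbb{T}^d=\mathbb{R}^d/\mathbb{Z}^d$ is the standard $d$-dimensional torus, $d\ge1$, and $\mathbb{R}^+=(0,\infty)$. Standing assumptions: (A1) $0\le\alpha<1$; (A2) $V:\mathbb{T}^d\times\mathbb{R}^+\to\mathbb{R}$ is $C^\infty$, globally bounded with bounded derivatives, and non-decreasing in its second variable $m$; (A3) $b:\mathbb{T}^d\to\mathbb{R}^d$ is $C^\infty$. A classical solution is a pair $(u,m)$ of $C^2$ functions $u,m:\mathbb{T}^d\to\mathbb{R}$ with $m>0$ satisfying the system pointwise. $\|\cdot\|_\infty$ denotes the supremum norm (over $\mathbb{T}^d$ for $b$, over $\mathbb{T}^d\times\mathbb{R}^+$ for $V$). *)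

theory Defs
  imports "HOL-Probability.Essential_Supremum"
begin

text \<open>Functions on the torus R^d/Z^d are represented by Z^d-periodic functions on
  \<^typ>\<open>real^'n\<close>, where d is the cardinality of \<open>'n\<close>.\<close>

definition torus_periodic :: "(real^'n \<Rightarrow> 'b) \<Rightarrow> bool" where
  "torus_periodic f \<longleftrightarrow> (\<forall>x k. (\<forall>i. k $ i \<in> \<int>) \<longrightarrow> f (x + k) = f x)"

text \<open>Haar measure of the torus, carried by the fundamental domain [0,1)^d.\<close>

definition torus_measure :: "(real^'n) measure" where
  "torus_measure = restrict_space lborel {x. \<forall>i. 0 \<le> x $ i \<and> x $ i < 1}"

definition Linfty_norm_torus :: "(real^'n \<Rightarrow> real) \<Rightarrow> ereal" where
  "Linfty_norm_torus f = esssup torus_measure (\<lambda>x. ereal \<bar>f x\<bar>)"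

text \<open>Only meaningful when \<open>f\<close> is bounded on \<open>S\<close>.\<close>

definition sup_norm_on :: "'a set \<Rightarrow> ('a \<Rightarrow> 'b::real_normed_vector) \<Rightarrow> real" where
  "sup_norm_on S f = (SUP x\<in>S. norm (f x))"

definition dir_deriv ::
    "'a::real_normed_vector \<Rightarrow> ('a \<Rightarrow> 'b::real_normed_vector) \<Rightarrow> 'a \<Rightarrow> 'b" where
  "dir_deriv v f x = frechet_derivative f (at x) v"

fun iter_deriv ::
    "'a::real_normed_vector list \<Rightarrow> ('a \<Rightarrow> 'b::real_normed_vector) \<Rightarrow> 'a \<Rightarrow> 'b" where
  "iter_deriv [] f = f"
| "iter_deriv (v # vs) f = dir_deriv v (iter_deriv vs f)"

text \<open>The class \<open>C\<^sup>k\<close> on \<open>S\<close>; to be used for open \<open>S\<close> only, since derivatives are taken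
  with respect to the full neighbourhood filter.\<close>

fun Ck_on :: "nat \<Rightarrow> ('a::euclidean_space \<Rightarrow> 'b::real_normed_vector) \<Rightarrow> 'a set \<Rightarrow> bool" where
  "Ck_on 0 f S \<longleftrightarrow> continuous_on S f"
| "Ck_on (Suc k) f S \<longleftrightarrow>
     (\<forall>x\<in>S. f differentiable (at x)) \<and> (\<forall>v\<in>Basis. Ck_on k (dir_deriv v f) S)"

definition Cinf_on :: "('a::euclidean_space \<Rightarrow> 'b::real_normed_vector) \<Rightarrow> 'a set \<Rightarrow> bool" where
  "Cinf_on f S \<longleftrightarrow> (\<forall>k. Ck_on k f S)"

text \<open>The empty list of directions gives boundedness of \<open>f\<close> itself.\<close>

definition bounded_derivs_on ::
    "('a::euclidean_space \<Rightarrow> 'b::real_normed_vector) \<Rightarrow> 'a set \<Rightarrow> bool" where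
  "bounded_derivs_on f S \<longleftrightarrow> (\<forall>vs. set vs \<subseteq> Basis \<longrightarrow> bounded (iter_deriv vs f ` S))"

definition partial_deriv :: "'n::finite \<Rightarrow> (real^'n \<Rightarrow> real) \<Rightarrow> real^'n \<Rightarrow> real" where
  "partial_deriv i = dir_deriv (axis i 1)"

definition grad :: "(real^'n \<Rightarrow> real) \<Rightarrow> real^'n \<Rightarrow> real^'n" where
  "grad f x = (\<chi> i. partial_deriv i f x)"

definition divergence :: "(real^'n \<Rightarrow> real^'n) \<Rightarrow> real^'n \<Rightarrow> real" where
  "divergence F x = (\<Sum>i\<in>UNIV. partial_deriv i (\<lambda>y. F y $ i) x)"

definition laplacian :: "(real^'n \<Rightarrow> real) \<Rightarrow> real^'n \<Rightarrow> real" where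
  "laplacian f x = (\<Sum>i\<in>UNIV. partial_deriv i (partial_deriv i f) x)"

text \<open>The potential is a function of the pair \<open>(x, m)\<close>; only its values for \<open>m > 0\<close> matter.\<close>

definition potential_assms :: "((real^'n) \<times> real \<Rightarrow> real) \<Rightarrow> bool" where
  "potential_assms V \<longleftrightarrow>
     (\<forall>r>0. torus_periodic (\<lambda>x. V (x, r))) \<and>
     Cinf_on V (UNIV \<times> {0<..}) \<and>
     bounded_derivs_on V (UNIV \<times> {0<..}) \<and>
     (\<forall>x. mono_on {0<..} (\<lambda>r. V (x, r)))"

definition drift_assms :: "(real^'n \<Rightarrow> real^'n) \<Rightarrow> bool" where
  "drift_assms b \<longleftrightarrow> torus_periodic b \<and> Cinf_on b UNIV"

definition classical_solution ::
    "real \<Rightarrow> ((real^'n) \<times> real \<Rightarrow> real) \<Rightarrow> (real^'n \<Rightarrow> real^'n) \<Rightarrow>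
     (real^'n \<Rightarrow> real) \<Rightarrow> (real^'n \<Rightarrow> real) \<Rightarrow> bool" where
  "classical_solution \<alpha> V b u m \<longleftrightarrow>
     torus_periodic u \<and> Ck_on 2 u UNIV \<and>
     torus_periodic m \<and> Ck_on 2 m UNIV \<and>
     (\<forall>x. m x > 0) \<and>
     (\<forall>x. u x - laplacian u x + (norm (grad u x))\<^sup>2 / (2 * m x powr \<alpha>) + b x \<bullet> grad u x
            = V (x, m x)) \<and>
     (\<forall>x. m x - laplacian m x - divergence (\<lambda>y. m y powr (1 - \<alpha>) *\<^sub>R grad u y) x
            - divergence (\<lambda>y. m y *\<^sub>R b y) x = 1)"

end

theory Submission
  imports Defs "HOL-Probability.Probability_Measure"
begin

text \<open>
  The bound comes from a Moser iteration for \<open>w = 1 / m\<close>. Write \<open>\<beta>\<close> and \<open>\<nu>\<close> for the supremum norms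
  of \<open>b\<close> and \<open>V\<close> and \<open>d\<close> for the dimension.

  The first equation enters only through a one-sided bound on the Laplacian
  (\<open>hamilton_jacobi_laplacian_bound\<close>): the minimum principle gives \<open>u \<ge> - \<nu>\<close>, and completing the
  square in \<open>Du\<close> turns the equation into \<open>- \<Delta> u \<le> 2 \<nu> + \<beta>\<^sup>2 m\<^sup>\<alpha> / 2\<close>. Test now the second equation
  with \<open>m\<^sup>-\<^sup>2\<^sup>p\<^sup>-\<^sup>1\<close>. The congestion term \<open>m\<^sup>1\<^sup>-\<^sup>\<alpha> Du\<close> multiplied by the gradient of this test function is a
  multiple of \<open>Du \<bullet> D (m\<^sup>-\<^sup>s)\<close> with \<open>s = 2 p + \<alpha>\<close>, so an integration by parts throws it onto
  \<open>- \<Delta> u\<close>, where the one-sided bound applies. The only dangerous term left is a multiple of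
  \<open>\<integral> w\<^bsup>2 p + \<alpha>\<^esup>\<close>; because \<open>\<alpha> < 1\<close>, it is absorbed by the good term \<open>\<integral> w\<^bsup>2 p + 1\<^esup>\<close>. The outcome
  (\<open>energy_estimate\<close>) contains \<open>\<integral> |D (w\<^sup>p)|\<^sup>2 \<le> K p\<^sup>2 \<integral> w\<^sup>2\<^sup>p\<close> for all \<open>p \<ge> 1\<close> and, for \<open>p = 1\<close>,
  a bound on \<open>\<integral> w\<close> (\<open>mean_reciprocal_bound\<close>), where \<open>K\<close> depends only on \<open>\<alpha>\<close>, \<open>\<beta>\<close> and \<open>\<nu>\<close>.

  To pass to the supremum, a Nash inequality is enough
  (\<open>torus_nash_inequality\<close>): \<open>\<integral> f\<^sup>2 \<le> (\<integral> f)\<^sup>2 / \<delta>\<^sup>d + (d \<delta>\<^sup>2 / 2) \<integral> |Df|\<^sup>2\<close> for \<open>f \<ge> 0\<close> and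
  \<open>0 < \<delta> \<le> 1\<close>. It follows from comparing \<open>f\<close> with its translates, by the translation
  invariance of Haar measure. For \<open>f = w\<^sup>p\<close> and \<open>\<delta>\<close> of order \<open>1 / p\<close> the gradient term is
  absorbed, and \<open>\<integral> w\<^sup>2\<^sup>p \<le> L p\<^sup>d (\<integral> w\<^sup>p)\<^sup>2\<close> (\<open>moment_doubling\<close>). Along \<open>p = 2\<^sup>j\<close> this recursion has
  the explicit consequence \<open>\<integral> w\<^sup>p \<le> (L 2\<^sup>d \<integral> w)\<^sup>p\<close> (\<open>doubling_recursion\<close>), and letting
  \<open>j\<close> tend to infinity bounds \<open>w\<close> almost everywhere (\<open>AE_le_of_dyadic_moments\<close>).
\<close>

section \<open>The torus as a probability space\<close>

lemma borel_cell: "{x :: real^'n. \<forall>i. 0 \<le> x $ i \<and> x $ i < \<delta>} \<in> sets borel"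
  by measurable

text \<open>The cells of side \<open>\<delta> \<le> 1\<close> serve as averaging windows in the Nash inequality; the cell of
  side 1 is the fundamental domain of the torus.\<close>

lemma emeasure_cell:
  assumes "0 \<le> \<delta>"
  shows "emeasure lborel {x :: real^'n. \<forall>i. 0 \<le> x $ i \<and> x $ i < \<delta>} = ennreal (\<delta> ^ CARD('n))"
proof (rule antisym)
  let ?S = "{x :: real^'n. \<forall>i. 0 \<le> x $ i \<and> x $ i < \<delta>}"
  have 1: "?S \<subseteq> cbox 0 (vec \<delta>)" "box 0 (vec \<delta>) \<subseteq> ?S"
    by (auto simp: mem_box_cart less_imp_le)
  have inner: "vec \<delta> \<bullet> i = \<delta>" if "i \<in> Basis" for i :: "real^'n"
    using that by (auto simp: Basis_vec_def inner_axis)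
  have c: "emeasure lborel (cbox (0::real^'n) (vec \<delta>)) = ennreal (\<delta> ^ CARD('n))"
    using assms by (simp add: emeasure_lborel_cbox_eq inner)
  have b: "emeasure lborel (box (0::real^'n) (vec \<delta>)) = emeasure lborel (cbox (0::real^'n) (vec \<delta>))"
    by (simp add: emeasure_lborel_cbox_eq emeasure_lborel_box_eq)
  show "emeasure lborel ?S \<le> ennreal (\<delta> ^ CARD('n))"
    using emeasure_mono[OF 1(1), of lborel] c by simp
  show "ennreal (\<delta> ^ CARD('n)) \<le> emeasure lborel ?S"
    using emeasure_mono[OF 1(2), of lborel] b c borel_cell by simp
qed

lemma space_torus_measure:
  "space (torus_measure :: (real^'n) measure) = {x. \<forall>i. 0 \<le> x $ i \<and> x $ i < 1}"
  by (simp add: torus_measure_def space_restrict_space)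

lemma prob_space_torus: "prob_space (torus_measure :: (real^'n) measure)"
  using emeasure_cell[of 1, where 'n='n] borel_cell[of 1, where 'n='n]
  by (intro prob_spaceI)
     (simp add: space_torus_measure torus_measure_def emeasure_restrict_space)

lemma continuous_borel_torus:
  fixes f :: "real^'n \<Rightarrow> 'b::topological_space"
  shows "continuous_on UNIV f \<Longrightarrow> f \<in> borel_measurable torus_measure"
  unfolding torus_measure_def
  by (intro measurable_restrict_space1) (simp add: borel_measurable_continuous_onI)

lemma torus_periodicD: "torus_periodic f \<Longrightarrow> (\<And>i. k $ i \<in> \<int>) \<Longrightarrow> f (x + k) = f x"
  by (auto simp: torus_periodic_def)

lemma torus_fract:
  fixes x :: "real^'n"
  defines "k \<equiv> (\<chi> i. - of_int \<lfloor>x $ i\<rfloor>)"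
  shows "\<And>i. k $ i \<in> \<int>" "\<And>i. 0 \<le> (x + k) $ i" "\<And>i. (x + k) $ i < 1"
  by (simp_all add: k_def) (linarith+)

lemma torus_periodic_range:
  fixes f :: "real^'n \<Rightarrow> 'b"
  assumes "torus_periodic f"
  shows "range f = f ` cbox 0 1"
proof -
  have "f x \<in> f ` cbox 0 1" for x
  proof -
    let ?k = "(\<chi> i. - of_int \<lfloor>x $ i\<rfloor>) :: real^'n"
    have "f x = f (x + ?k)"
      using torus_periodicD[OF assms torus_fract(1)[of x]] by simp
    moreover have "x + ?k \<in> cbox 0 1"
      using torus_fract(2,3)[of x] by (auto simp: mem_box_cart less_imp_le)
    ultimately show ?thesis by blast
  qed
  then show ?thesis by blast
qed

lemma periodic_continuous_bounded:
  fixes f :: "real^'n \<Rightarrow> 'b::real_normed_vector"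
  assumes "torus_periodic f" "continuous_on UNIV f"
  shows "bounded (range f)"
  unfolding torus_periodic_range[OF assms(1)]
  by (intro compact_imp_bounded compact_continuous_image compact_cbox)
     (use assms(2) continuous_on_subset in blast)

lemma periodic_continuous_integrable:
  fixes f :: "real^'n \<Rightarrow> real"
  assumes "torus_periodic f" "continuous_on UNIV f"
  shows "integrable torus_measure f"
proof -
  interpret prob_space "torus_measure :: (real^'n) measure" by (rule prob_space_torus)
  obtain B where "\<And>x. norm (f x) \<le> B"
    using periodic_continuous_bounded[OF assms] by (auto simp: bounded_iff)
  then show ?thesis
    by (intro integrable_const_bound[where B=B] continuous_borel_torus assms) auto
qed

section \<open>Translation invariance of integrals over the torus\<close>

lemma nn_integral_lborel_shift:
  fixes f :: "'a::euclidean_space \<Rightarrow> ennreal"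
  assumes "f \<in> borel_measurable borel"
  shows "(\<integral>\<^sup>+x. f (x + h) \<partial>lborel) = (\<integral>\<^sup>+x. f x \<partial>lborel)"
proof -
  have "(\<integral>\<^sup>+x. f x \<partial>lborel) = (\<integral>\<^sup>+x. f x \<partial>distr lborel borel ((+) h))"
    by (simp add: lborel_distr_plus)
  also have "\<dots> = (\<integral>\<^sup>+x. f (h + x) \<partial>lborel)"
    using assms by (subst nn_integral_distr) auto
  finally show ?thesis by (simp add: add.commute)
qed

lemma countable_lattice: "countable {k :: real^'n. \<forall>i. k $ i \<in> \<int>}"
proof (rule countable_subset)
  show "{k :: real^'n. \<forall>i. k $ i \<in> \<int>} \<subseteq> vec_lambda ` (PiE UNIV (\<lambda>_. \<int>))"
  proof
    fix k :: "real^'n" assume "k \<in> {k. \<forall>i. k $ i \<in> \<int>}"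
    then have "($) k \<in> PiE UNIV (\<lambda>_. \<int>)" by auto
    then show "k \<in> vec_lambda ` (PiE UNIV (\<lambda>_. \<int>))"
      by (metis vec_nth_inverse image_eqI)
  qed
  show "countable (vec_lambda ` (PiE (UNIV :: 'n set) (\<lambda>_. \<int> :: real set)))"
    by (intro countable_image countable_PiE) (auto simp: Ints_def)
qed

lemma lattice_unique:
  fixes x :: "real^'n"
  obtains k where "\<And>i. k $ i \<in> \<int>"
    "\<And>l. (\<And>i. l $ i \<in> \<int>) \<Longrightarrow> (\<forall>i. 0 \<le> (x + l) $ i \<and> (x + l) $ i < 1) \<longleftrightarrow> l = k"
proof
  let ?k = "(\<chi> i. - of_int \<lfloor>x $ i\<rfloor>) :: real^'n"
  show "?k $ i \<in> \<int>" for i by simp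
  fix l :: "real^'n" assume l: "\<And>i. l $ i \<in> \<int>"
  show "(\<forall>i. 0 \<le> (x + l) $ i \<and> (x + l) $ i < 1) \<longleftrightarrow> l = ?k"
  proof
    assume *: "\<forall>i. 0 \<le> (x + l) $ i \<and> (x + l) $ i < 1"
    have "l $ i = - of_int \<lfloor>x $ i\<rfloor>" for i
    proof -
      obtain z where z: "l $ i = of_int z" using l[of i] by (auto elim: Ints_cases)
      have "\<lfloor>x $ i\<rfloor> = - z"
        using *[rule_format, of i] z by (intro floor_unique) auto
      then show ?thesis using z by simp
    qed
    then show "l = ?k" by (simp add: vec_eq_iff)
  next
    assume "l = ?k"
    then show "\<forall>i. 0 \<le> (x + l) $ i \<and> (x + l) $ i < 1" using torus_fract(2,3)[of x] by simp
  qed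
qed

text \<open>The lattice translates of the unit cell tile space. Both signs occur below: the lattice sum
  is inserted with one of them and, after a translation of the integration variable, removed with
  the other.\<close>

lemma nn_integral_lattice_tile:
  fixes x :: "real^'n" and c :: ennreal
  defines "Q \<equiv> {x :: real^'n. \<forall>i. 0 \<le> x $ i \<and> x $ i < 1}"
  assumes \<sigma>: "\<sigma> = 1 \<or> \<sigma> = (-1 :: real)"
  shows "(\<integral>\<^sup>+k. c * indicator Q (x + \<sigma> *\<^sub>R k) \<partial>count_space {k. \<forall>i. k $ i \<in> \<int>}) = c"
proof -
  obtain k where k: "\<And>i. k $ i \<in> \<int>"
    "\<And>l. (\<And>i. l $ i \<in> \<int>) \<Longrightarrow> (x + l \<in> Q) \<longleftrightarrow> l = k"
    using lattice_unique[of x] unfolding Q_def mem_Collect_eq by metis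
  have "x + \<sigma> *\<^sub>R l \<in> Q \<longleftrightarrow> l = \<sigma> *\<^sub>R k" if "\<forall>i. l $ i \<in> \<int>" for l
    using k(2)[of "\<sigma> *\<^sub>R l"] that \<sigma> by (auto simp: minus_equation_iff)
  then have "(\<integral>\<^sup>+l. c * indicator Q (x + \<sigma> *\<^sub>R l) \<partial>count_space {k. \<forall>i. k $ i \<in> \<int>})
      = (\<integral>\<^sup>+l. c * indicator {\<sigma> *\<^sub>R k} l \<partial>count_space {k. \<forall>i. k $ i \<in> \<int>})"
    by (intro nn_integral_cong) (auto simp: indicator_def)
  also have "\<dots> = c"
    using k(1) \<sigma> by (subst nn_integral_cmult_indicator) auto
  finally show ?thesis .
qed

text \<open>Haar measure is invariant: cut the translated cell \<open>Q + h\<close> into its intersections with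
  the lattice translates of \<open>Q\<close> and move each piece back into \<open>Q\<close>, which by periodicity of the
  integrand changes nothing.\<close>

lemma nn_integral_torus_shift:
  fixes f :: "real^'n \<Rightarrow> ennreal"
  assumes f[measurable]: "f \<in> borel_measurable borel" and per: "torus_periodic f"
  shows "(\<integral>\<^sup>+x. f (x + h) \<partial>torus_measure) = (\<integral>\<^sup>+x. f x \<partial>torus_measure)"
proof -
  define Q where "Q = {x :: real^'n. \<forall>i. 0 \<le> x $ i \<and> x $ i < 1}"
  define I where "I = {k :: real^'n. \<forall>i. k $ i \<in> \<int>}"
  have [measurable]: "Q \<in> sets borel" unfolding Q_def by (rule borel_cell)
  have torus: "(\<integral>\<^sup>+x. g x \<partial>torus_measure) = (\<integral>\<^sup>+x. g x * indicator Q x \<partial>lborel)" for g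
    unfolding torus_measure_def Q_def by (intro nn_integral_restrict_space) (simp add: borel_cell)
  note tile = nn_integral_lattice_tile[where 'n='n, folded Q_def I_def]
  have I: "countable I" unfolding I_def by (rule countable_lattice)
  have "(\<integral>\<^sup>+x. f (x + h) \<partial>torus_measure) = (\<integral>\<^sup>+x. f (x + h) * indicator Q (x + h - h) \<partial>lborel)"
    by (simp add: torus)
  also have "\<dots> = (\<integral>\<^sup>+x. f x * indicator Q (x - h) \<partial>lborel)"
    by (rule nn_integral_lborel_shift) measurable
  also have "\<dots> = (\<integral>\<^sup>+x. \<integral>\<^sup>+k. (f x * indicator Q (x - h)) * indicator Q (x + (-1) *\<^sub>R k) \<partial>count_space I \<partial>lborel)"
    by (simp only: tile[OF disjI2[OF refl]])
  also have "\<dots> = (\<integral>\<^sup>+k. \<integral>\<^sup>+x. f x * indicator Q (x - h) * indicator Q (x + (-1) *\<^sub>R k) \<partial>lborel \<partial>count_space I)"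
    by (rule nn_integral_count_space_nn_integral[OF I]) measurable
  also have "\<dots> = (\<integral>\<^sup>+k. \<integral>\<^sup>+x. f x * indicator Q x * indicator Q (x - h + 1 *\<^sub>R k) \<partial>lborel \<partial>count_space I)"
  proof (rule nn_integral_cong)
    fix k assume "k \<in> space (count_space I)"
    then have "f (x + k) = f x" for x by (intro torus_periodicD per) (auto simp: I_def)
    then have "(\<integral>\<^sup>+x. f x * indicator Q x * indicator Q (x - h + 1 *\<^sub>R k) \<partial>lborel)
       = (\<integral>\<^sup>+x. f (x + k) * indicator Q (x + k - h) * indicator Q (x + k + (-1) *\<^sub>R k) \<partial>lborel)"
      by (simp add: algebra_simps)
    also have "\<dots> = (\<integral>\<^sup>+x. f x * indicator Q (x - h) * indicator Q (x + (-1) *\<^sub>R k) \<partial>lborel)"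
      by (rule nn_integral_lborel_shift) measurable
    finally show "(\<integral>\<^sup>+x. f x * indicator Q (x - h) * indicator Q (x + (-1) *\<^sub>R k) \<partial>lborel)
      = (\<integral>\<^sup>+x. f x * indicator Q x * indicator Q (x - h + 1 *\<^sub>R k) \<partial>lborel)" by simp
  qed
  also have "\<dots> = (\<integral>\<^sup>+x. \<integral>\<^sup>+k. f x * indicator Q x * indicator Q (x - h + 1 *\<^sub>R k) \<partial>count_space I \<partial>lborel)"
    by (rule nn_integral_count_space_nn_integral[OF I, symmetric]) measurable
  also have "\<dots> = (\<integral>\<^sup>+x. f x * indicator Q x \<partial>lborel)"
    by (simp only: tile[OF disjI1[OF refl]])
  finally show ?thesis by (simp add: torus)
qed

lemma torus_periodic_shift: "torus_periodic f \<Longrightarrow> torus_periodic (\<lambda>x. f (x + h))"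
  unfolding torus_periodic_def by (metis add.assoc add.commute)

lemma integral_torus_shift:
  fixes f :: "real^'n \<Rightarrow> real"
  assumes per: "torus_periodic f" and cont: "continuous_on UNIV f"
  shows "(\<integral>x. f (x + h) \<partial>torus_measure) = (\<integral>x. f x \<partial>torus_measure)"
proof -
  interpret prob_space "torus_measure :: (real^'n) measure" by (rule prob_space_torus)
  \<comment> \<open>Adding a bound makes the integrand nonnegative, so the invariance of nonnegative integrals applies.\<close>
  obtain B where B: "\<And>x. norm (f x) \<le> B"
    using periodic_continuous_bounded[OF per cont] by (auto simp: bounded_iff)
  then have pos: "0 \<le> f x + B" for x by (smt (verit) real_norm_def)
  have int: "integrable torus_measure (\<lambda>x. f (x + k))" for k
    by (intro periodic_continuous_integrable torus_periodic_shift per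
        continuous_on_compose2[OF cont] continuous_intros) auto
  have nn: "ennreal ((\<integral>x. f (x + k) \<partial>torus_measure) + B) = (\<integral>\<^sup>+x. ennreal (f (x + k) + B) \<partial>torus_measure)" for k
    using int[of k] pos by (subst nn_integral_eq_integral) (auto simp: prob_space)
  have "(\<integral>\<^sup>+x. ennreal (f (x + h) + B) \<partial>torus_measure) = (\<integral>\<^sup>+x. ennreal (f x + B) \<partial>torus_measure)"
    using cont per
    by (intro nn_integral_torus_shift[where f="\<lambda>x. ennreal (f x + B)"])
       (auto simp: torus_periodic_def intro!: borel_measurable_continuous_onI
          continuous_on_ennreal continuous_intros)
  then have "ennreal ((\<integral>x. f (x + h) \<partial>torus_measure) + B) = ennreal ((\<integral>x. f x \<partial>torus_measure) + B)"
    using nn[of h] nn[of 0] by simp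
  moreover have nonneg: "0 \<le> (\<integral>x. f (x + k) \<partial>torus_measure) + B" for k
  proof -
    have "0 \<le> (\<integral>x. f (x + k) + B \<partial>torus_measure)" by (intro Bochner_Integration.integral_nonneg pos)
    also have "\<dots> = (\<integral>x. f (x + k) \<partial>torus_measure) + B"
      using int[of k] by (simp add: prob_space)
    finally show ?thesis .
  qed
  ultimately show ?thesis using nonneg[of h] nonneg[of 0] by simp
qed

section \<open>Averages along segments\<close>

abbreviation unit_interval :: "real measure" where
  "unit_interval \<equiv> restrict_space lborel {0..1}"

lemma prob_space_unit_interval: "prob_space unit_interval"
  by (intro prob_spaceI) (simp add: space_restrict_space emeasure_restrict_space)

lemma continuous_borel_unit_interval:
  "continuous_on UNIV f \<Longrightarrow> f \<in> borel_measurable unit_interval"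
  by (intro measurable_restrict_space1) (simp add: borel_measurable_continuous_onI)

lemma integrable_unit_interval:
  fixes f :: "real \<Rightarrow> real"
  assumes "continuous_on UNIV f"
  shows "integrable unit_interval f"
proof -
  interpret prob_space unit_interval by (rule prob_space_unit_interval)
  have "bounded (f ` {0..1})"
    using assms by (intro compact_imp_bounded compact_continuous_image) (auto intro: continuous_on_subset)
  then obtain B where "\<And>x. x \<in> {0..1} \<Longrightarrow> norm (f x) \<le> B"
    unfolding bounded_iff by blast
  then show ?thesis
    by (intro integrable_const_bound[where B=B] continuous_borel_unit_interval assms)
       (auto simp: space_restrict_space)
qed

lemma integral_unit_interval_FTC:
  fixes f :: "real \<Rightarrow> real"
  assumes "\<And>t. (F has_real_derivative f t) (at t)" "continuous_on UNIV f"
  shows "(\<integral>t. f t \<partial>unit_interval) = F 1 - F 0"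
proof -
  have "(\<integral>t. f t \<partial>unit_interval) = (\<integral>t. f t * indicator {0..1} t \<partial>lborel)"
    by (subst integral_restrict_space) (auto simp: mult.commute)
  also have "\<dots> = F 1 - F 0"
    using assms by (intro integral_FTC_Icc_real) (auto simp: continuous_on_eq_continuous_at)
  finally show ?thesis .
qed

lemma borel_measurable_pair_continuous:
  fixes G :: "'a::second_countable_topology \<times> 'b::second_countable_topology \<Rightarrow> real"
  assumes "continuous_on UNIV G"
    "(\<lambda>x. x) \<in> borel_measurable M" "(\<lambda>y. y) \<in> borel_measurable N"
  shows "G \<in> borel_measurable (M \<Otimes>\<^sub>M N)"
proof -
  have "fst \<in> borel_measurable (M \<Otimes>\<^sub>M N)" "snd \<in> borel_measurable (M \<Otimes>\<^sub>M N)"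
    using measurable_compose[OF measurable_fst assms(2), of N]
      measurable_compose[OF measurable_snd assms(3), of M] by simp_all
  then have "(\<lambda>p. p) \<in> measurable (M \<Otimes>\<^sub>M N) (borel \<Otimes>\<^sub>M borel)"
    by (simp add: measurable_pair_iff comp_def)
  moreover have "G \<in> borel_measurable (borel \<Otimes>\<^sub>M borel)"
    unfolding borel_prod using assms(1) by (rule borel_measurable_continuous_onI)
  ultimately show ?thesis by (rule measurable_compose)
qed

text \<open>Averaging a periodic function along a segment does not change its integral over the torus.
  Applied to a derivative this gives integration by parts, and applied to the square of a derivative
  it bounds difference quotients in \<open>L\<^sup>2\<close>.\<close>

lemma integral_torus_segment_average:
  fixes g :: "real^'n \<Rightarrow> real"
  assumes per: "torus_periodic g" and cont: "continuous_on UNIV g"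
  shows "(\<integral>x. (\<integral>t. g (x + t *\<^sub>R h) \<partial>unit_interval) \<partial>torus_measure) = (\<integral>x. g x \<partial>torus_measure)"
    and "integrable torus_measure (\<lambda>x. \<integral>t. g (x + t *\<^sub>R h) \<partial>unit_interval)"
proof -
  interpret T: prob_space "torus_measure :: (real^'n) measure" by (rule prob_space_torus)
  interpret U: prob_space unit_interval by (rule prob_space_unit_interval)
  interpret P: pair_prob_space "torus_measure :: (real^'n) measure" unit_interval ..
  obtain B where B: "\<And>x. norm (g x) \<le> B"
    using periodic_continuous_bounded[OF per cont] by (auto simp: bounded_iff)
  have "continuous_on UNIV (\<lambda>p. g (fst p + snd p *\<^sub>R h))"
    by (rule continuous_on_compose2[OF cont]) (auto intro!: continuous_intros)
  then have "(\<lambda>p. g (fst p + snd p *\<^sub>R h)) \<in> borel_measurable (torus_measure \<Otimes>\<^sub>M unit_interval)"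
    by (intro borel_measurable_pair_continuous continuous_borel_torus
        continuous_borel_unit_interval continuous_on_id)
  then have int: "integrable (torus_measure \<Otimes>\<^sub>M unit_interval) (\<lambda>(x, t). g (x + t *\<^sub>R h))"
    using B by (intro P.integrable_const_bound[where B=B]) (auto simp: case_prod_beta)
  show "integrable torus_measure (\<lambda>x. \<integral>t. g (x + t *\<^sub>R h) \<partial>unit_interval)"
    using P.integrable_fst[OF int] .
  have "(\<integral>x. (\<integral>t. g (x + t *\<^sub>R h) \<partial>unit_interval) \<partial>torus_measure)
     = (\<integral>t. (\<integral>x. g (x + t *\<^sub>R h) \<partial>torus_measure) \<partial>unit_interval)"
    using P.Fubini_integral[OF int] by simp
  also have "\<dots> = (\<integral>x. g x \<partial>torus_measure)"
    using U.prob_space by (simp add: integral_torus_shift[OF per cont] space_restrict_space)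
  finally show "(\<integral>x. (\<integral>t. g (x + t *\<^sub>R h) \<partial>unit_interval) \<partial>torus_measure) = (\<integral>x. g x \<partial>torus_measure)" .
qed

section \<open>Continuous and continuously differentiable functions on the torus\<close>

definition torus_C0 :: "(real^'n \<Rightarrow> 'b::topological_space) \<Rightarrow> bool" where
  "torus_C0 f \<longleftrightarrow> torus_periodic f \<and> continuous_on UNIV f"

lemma torus_C0_integrable: "torus_C0 f \<Longrightarrow> integrable torus_measure f"
  for f :: "real^'n \<Rightarrow> real"
  by (simp add: torus_C0_def periodic_continuous_integrable)

lemma torus_C0_const: "torus_C0 (\<lambda>x. c)"
  by (simp add: torus_C0_def torus_periodic_def)

lemma torus_C0_add: "torus_C0 f \<Longrightarrow> torus_C0 g \<Longrightarrow> torus_C0 (\<lambda>x. f x + g x)"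
  for f g :: "real^'n \<Rightarrow> 'b::topological_monoid_add"
  by (auto simp: torus_C0_def torus_periodic_def intro: continuous_intros)

lemma torus_C0_diff: "torus_C0 f \<Longrightarrow> torus_C0 g \<Longrightarrow> torus_C0 (\<lambda>x. f x - g x)"
  for f g :: "real^'n \<Rightarrow> 'b::topological_group_add"
  by (auto simp: torus_C0_def torus_periodic_def intro: continuous_intros)

lemma torus_C0_mult: "torus_C0 f \<Longrightarrow> torus_C0 g \<Longrightarrow> torus_C0 (\<lambda>x. f x * g x)"
  for f g :: "real^'n \<Rightarrow> real"
  by (auto simp: torus_C0_def torus_periodic_def intro: continuous_intros)

lemma torus_C0_scaleR: "torus_C0 f \<Longrightarrow> torus_C0 g \<Longrightarrow> torus_C0 (\<lambda>x. f x *\<^sub>R g x)"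
  for g :: "real^'n \<Rightarrow> 'b::real_normed_vector"
  by (auto simp: torus_C0_def torus_periodic_def intro: continuous_intros)

lemma torus_C0_power: "torus_C0 f \<Longrightarrow> torus_C0 (\<lambda>x. f x ^ k)"
  for f :: "real^'n \<Rightarrow> real"
  by (auto simp: torus_C0_def torus_periodic_def intro: continuous_intros)

lemma torus_C0_inner: "torus_C0 f \<Longrightarrow> torus_C0 g \<Longrightarrow> torus_C0 (\<lambda>x. f x \<bullet> g x)"
  for f g :: "real^'n \<Rightarrow> 'b::real_inner"
  by (auto simp: torus_C0_def torus_periodic_def intro: continuous_intros)

lemma torus_C0_norm: "torus_C0 f \<Longrightarrow> torus_C0 (\<lambda>x. norm (f x))"
  for f :: "real^'n \<Rightarrow> 'b::real_normed_vector"
  by (auto simp: torus_C0_def torus_periodic_def intro: continuous_intros)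

lemma torus_C0_component: "torus_C0 f \<Longrightarrow> torus_C0 (\<lambda>x. f x $ i)"
  for f :: "real^'n \<Rightarrow> real^'k"
  by (auto simp: torus_C0_def torus_periodic_def intro: continuous_intros)

lemma torus_C0_powr:
  fixes f :: "real^'n \<Rightarrow> real"
  assumes "torus_C0 f" "\<And>x. 0 < f x"
  shows "torus_C0 (\<lambda>x. f x powr a)"
proof -
  have "continuous_on UNIV (\<lambda>x. f x powr a)"
    using assms by (intro continuous_on_powr continuous_on_const) (auto simp: torus_C0_def less_le)
  then show ?thesis using assms by (simp add: torus_C0_def torus_periodic_def)
qed

lemma torus_C0_shift:
  assumes "torus_C0 f"
  shows "torus_C0 (\<lambda>x. f (x + h))"
proof -
  have "continuous_on UNIV (\<lambda>x. f (x + h))"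
    by (rule continuous_on_compose2[of UNIV f])
       (use assms in \<open>auto simp: torus_C0_def intro: continuous_intros\<close>)
  then show ?thesis using assms by (simp add: torus_C0_def torus_periodic_shift)
qed

lemmas torus_C0_intros = torus_C0_const torus_C0_add torus_C0_diff torus_C0_mult
  torus_C0_scaleR torus_C0_power torus_C0_inner torus_C0_norm torus_C0_component

lemma dir_deriv_eq: "(f has_derivative f') (at x) \<Longrightarrow> dir_deriv v f x = f' v"
  by (simp add: dir_deriv_def frechet_derivative_at[symmetric])

lemma grad_eq:
  assumes "GDERIV f x :> g"
  shows "grad f x = g"
  using dir_deriv_eq[OF assms[unfolded gderiv_def]]
  by (simp add: vec_eq_iff grad_def partial_deriv_def inner_axis')

lemma GDERIV_grad:
  fixes f :: "real^'n \<Rightarrow> real"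
  assumes "f differentiable (at x)"
  shows "GDERIV f x :> grad f x"
proof -
  obtain f' where f': "(f has_derivative f') (at x)" using assms by (auto simp: differentiable_def)
  interpret linear f' using f' by (rule has_derivative_linear)
  have "f' h = h \<bullet> grad f x" for h
  proof -
    have "f' h = f' (\<Sum>i\<in>UNIV. h $ i *\<^sub>R axis i 1)"
      using basis_expansion[of h] by (simp add: scalar_mult_eq_scaleR)
    also have "\<dots> = (\<Sum>i\<in>UNIV. h $ i * f' (axis i 1))" by (simp add: sum scale)
    also have "\<dots> = h \<bullet> grad f x"
      by (simp add: inner_vec_def grad_def partial_deriv_def dir_deriv_eq[OF f'])
    finally show ?thesis .
  qed
  then have "f' = (\<lambda>h. h \<bullet> grad f x)" by blast
  then show ?thesis using f' unfolding gderiv_def by simp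
qed

definition torus_C1 :: "(real^'n \<Rightarrow> real) \<Rightarrow> bool" where
  "torus_C1 f \<longleftrightarrow>
     torus_periodic f \<and> (\<forall>x. f differentiable (at x)) \<and> continuous_on UNIV (grad f)"

lemma torus_C1_GDERIV: "torus_C1 f \<Longrightarrow> GDERIV f x :> grad f x"
  by (simp add: torus_C1_def GDERIV_grad)

lemma torus_C1_C0: "torus_C1 f \<Longrightarrow> torus_C0 f"
  unfolding torus_C1_def torus_C0_def
  by (metis continuous_at_imp_continuous_on differentiable_imp_continuous_within)

text \<open>The gradient inherits periodicity because derivatives commute with translations.\<close>

lemma torus_C1_grad_C0: "torus_C0 (grad f)" if f: "torus_C1 f"
proof -
  have "grad f (x + k) = grad f x" if k: "\<forall>i. k $ i \<in> \<int>" for x k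
  proof -
    have "((\<lambda>y. y + k) has_derivative (\<lambda>h. h)) (at x)"
      by (auto intro!: derivative_eq_intros)
    from has_derivative_compose[OF this torus_C1_GDERIV[OF f, unfolded gderiv_def]]
    have "((\<lambda>y. f (y + k)) has_derivative (\<lambda>h. h \<bullet> grad f (x + k))) (at x)" .
    moreover have "(\<lambda>y. f (y + k)) = f"
      using f k by (auto simp: torus_C1_def torus_periodic_def)
    ultimately show ?thesis by (metis grad_eq gderiv_def)
  qed
  then show ?thesis using f by (auto simp: torus_C1_def torus_C0_def torus_periodic_def)
qed

lemma torus_C1I:
  assumes "torus_periodic f" "\<And>x. GDERIV f x :> g x" "continuous_on UNIV g"
  shows "torus_C1 f" "grad f = g"
proof -
  show g: "grad f = g" using grad_eq[OF assms(2)] by blast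
  have "f differentiable (at x)" for x
    using assms(2)[of x] by (auto simp: gderiv_def differentiable_def)
  then show "torus_C1 f" using assms g by (simp add: torus_C1_def)
qed

lemma torus_C1_mult:
  assumes "torus_C1 f" "torus_C1 g"
  shows "torus_C1 (\<lambda>x. f x * g x)"
    "grad (\<lambda>x. f x * g x) = (\<lambda>x. f x *\<^sub>R grad g x + g x *\<^sub>R grad f x)"
  using torus_C1I[OF _ GDERIV_mult[OF torus_C1_GDERIV[OF assms(1)] torus_C1_GDERIV[OF assms(2)]]]
    torus_C0_add[OF torus_C0_scaleR[OF torus_C1_C0[OF assms(1)] torus_C1_grad_C0[OF assms(2)]]
       torus_C0_scaleR[OF torus_C1_C0[OF assms(2)] torus_C1_grad_C0[OF assms(1)]]]
    torus_C0_mult[OF torus_C1_C0[OF assms(1)] torus_C1_C0[OF assms(2)]]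
  by (auto simp: torus_C0_def)

lemma torus_C1_powr:
  assumes f: "torus_C1 f" and pos: "\<And>x. 0 < f x"
  shows "torus_C1 (\<lambda>x. f x powr a)"
    "grad (\<lambda>x. f x powr a) = (\<lambda>x. (a * f x powr (a - 1)) *\<^sub>R grad f x)"
proof -
  have *: "torus_C0 (\<lambda>x. f x powr a)" "torus_C0 (\<lambda>x. (a * f x powr (a - 1)) *\<^sub>R grad f x)"
    by (intro torus_C0_intros torus_C0_powr torus_C1_C0 torus_C1_grad_C0 f pos)+
  have "GDERIV (\<lambda>x. f x powr a) x :> (a * f x powr (a - 1)) *\<^sub>R grad f x" for x
    using pos[of x]
    by (intro GDERIV_DERIV_compose[OF torus_C1_GDERIV[OF f]] has_real_derivative_powr)
  from torus_C1I[OF _ this] * show "torus_C1 (\<lambda>x. f x powr a)"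
    "grad (\<lambda>x. f x powr a) = (\<lambda>x. (a * f x powr (a - 1)) *\<^sub>R grad f x)"
    by (auto simp: torus_C0_def)
qed

lemma Ck_on_continuous:
  "Ck_on k f S \<Longrightarrow> continuous_on S f"
  by (cases k) (auto intro!: continuous_at_imp_continuous_on differentiable_imp_continuous_within)

lemma torus_C1_Ck:
  assumes "torus_periodic f" "Ck_on (Suc k) f UNIV"
  shows "torus_C1 f"
proof -
  have "continuous_on UNIV (\<lambda>x. \<chi> i. partial_deriv i f x)"
    using assms(2) unfolding partial_deriv_def
    by (intro continuous_on_vec_lambda) (auto intro!: Ck_on_continuous)
  moreover have "grad f = (\<lambda>x. \<chi> i. partial_deriv i f x)" by (simp add: grad_def fun_eq_iff)
  ultimately have "continuous_on UNIV (grad f)" by (simp only:)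
  then show ?thesis using assms by (simp add: torus_C1_def)
qed

lemma torus_C1_partial_Ck:
  assumes "torus_periodic f" "Ck_on (Suc (Suc k)) f UNIV"
  shows "torus_C1 (\<lambda>y. grad f y $ i)"
proof (rule torus_C1_Ck)
  show "torus_periodic (\<lambda>y. grad f y $ i)"
    using torus_C1_grad_C0[OF torus_C1_Ck[OF assms]] by (simp add: torus_C0_def torus_periodic_def)
  have "(\<lambda>y. grad f y $ i) = dir_deriv (axis i 1) f"
    by (simp add: grad_def partial_deriv_def)
  then show "Ck_on (Suc k) (\<lambda>y. grad f y $ i) UNIV"
    using assms(2) by (auto simp del: Ck_on.simps simp: Ck_on.simps(2)[of "Suc k"])
qed

section \<open>Integration by parts\<close>

lemma DERIV_segment:
  assumes "torus_C1 f"
  shows "((\<lambda>t. f (x + t *\<^sub>R h)) has_real_derivative (grad f (x + t *\<^sub>R h) \<bullet> h)) (at t)"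
proof -
  have "((\<lambda>t. x + t *\<^sub>R h) has_derivative (\<lambda>s. s *\<^sub>R h)) (at t)"
    by (auto intro!: derivative_eq_intros)
  from has_derivative_compose[OF this torus_C1_GDERIV[OF assms, unfolded gderiv_def]]
  have "((\<lambda>t. f (x + t *\<^sub>R h)) has_derivative (\<lambda>s. (s *\<^sub>R h) \<bullet> grad f (x + t *\<^sub>R h))) (at t)" .
  moreover have "(\<lambda>s. (s *\<^sub>R h) \<bullet> grad f (x + t *\<^sub>R h)) = (*) (grad f (x + t *\<^sub>R h) \<bullet> h)"
    by (simp add: fun_eq_iff inner_commute)
  ultimately show ?thesis by (simp add: has_field_derivative_def)
qed

lemma segment_continuous:
  assumes "torus_C0 f"
  shows "continuous_on UNIV (\<lambda>t. f (x + t *\<^sub>R h))"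
  by (rule continuous_on_compose2[of UNIV f])
     (use assms in \<open>auto simp: torus_C0_def intro!: continuous_intros\<close>)

lemma integral_segment_grad:
  assumes "torus_C1 f"
  shows "(\<integral>t. grad f (x + t *\<^sub>R h) \<bullet> h \<partial>unit_interval) = f (x + h) - f x"
  using segment_continuous[OF torus_C0_inner[OF torus_C1_grad_C0[OF assms] torus_C0_const]]
  by (subst integral_unit_interval_FTC[OF DERIV_segment[OF assms]]) auto

text \<open>The average of \<open>\<partial>\<^sub>i f\<close> over the segment from \<open>x\<close> to \<open>x + e\<^sub>i\<close> is
  \<open>f (x + e\<^sub>i) - f x = 0\<close>, and this averaging preserves the integral over the torus.\<close>

lemma integral_partial_deriv_zero:
  fixes f :: "real^'n \<Rightarrow> real"
  assumes f: "torus_C1 f"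
  shows "(\<integral>x. partial_deriv i f x \<partial>torus_measure) = 0"
proof -
  have "torus_C0 (\<lambda>x. grad f x \<bullet> axis i 1)"
    by (intro torus_C0_intros torus_C1_grad_C0 f)
  then have "(\<integral>x. grad f x \<bullet> axis i 1 \<partial>torus_measure)
      = (\<integral>x. f (x + axis i 1) - f x \<partial>torus_measure)"
    using integral_torus_segment_average(1)[of "\<lambda>x. grad f x \<bullet> axis i 1" "axis i 1"]
      integral_segment_grad[OF f, of _ "axis i 1"]
    by (simp add: torus_C0_def)
  also have "\<dots> = 0"
    using f by (auto simp: torus_C1_def torus_periodic_def axis_def)
  finally show ?thesis by (simp add: inner_axis grad_def)
qed

lemma torus_by_parts:
  fixes f g :: "real^'n \<Rightarrow> real"
  assumes f: "torus_C1 f" and g: "torus_C1 g"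
  shows "(\<integral>x. partial_deriv i f x * g x \<partial>torus_measure)
       = - (\<integral>x. f x * partial_deriv i g x \<partial>torus_measure)"
proof -
  have p: "partial_deriv i h = (\<lambda>x. grad h x $ i)" for h :: "real^'n \<Rightarrow> real"
    by (simp add: grad_def fun_eq_iff)
  have "integrable torus_measure (\<lambda>x. partial_deriv i f x * g x)"
    "integrable torus_measure (\<lambda>x. f x * partial_deriv i g x)"
    unfolding p
    by (intro torus_C0_integrable torus_C0_intros torus_C1_grad_C0 torus_C1_C0 f g)+
  moreover have "(\<integral>x. partial_deriv i f x * g x + f x * partial_deriv i g x \<partial>torus_measure) = 0"
    using integral_partial_deriv_zero[OF torus_C1_mult(1)[OF f g], of i]
    by (simp add: p torus_C1_mult(2)[OF f g] algebra_simps)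
  ultimately show ?thesis by simp
qed

lemma torus_divergence_theorem:
  fixes F :: "real^'n \<Rightarrow> real^'n"
  assumes F: "\<And>i. torus_C1 (\<lambda>y. F y $ i)" and g: "torus_C1 g"
  shows "(\<integral>x. divergence F x * g x \<partial>torus_measure) = - (\<integral>x. F x \<bullet> grad g x \<partial>torus_measure)"
    and "integrable torus_measure (\<lambda>x. divergence F x * g x)"
proof -
  have p: "partial_deriv i h = (\<lambda>x. grad h x $ i)" for h :: "real^'n \<Rightarrow> real" and i
    by (simp add: grad_def fun_eq_iff)
  have int: "integrable torus_measure (\<lambda>x. partial_deriv i (\<lambda>y. F y $ i) x * g x)"
    "integrable torus_measure (\<lambda>x. F x $ i * partial_deriv i g x)" for i
    unfolding p
    by (intro torus_C0_integrable torus_C0_intros(1-9) torus_C0_component[OF torus_C1_grad_C0] torus_C1_C0 F g)+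
  have d: "(\<lambda>x. divergence F x * g x) = (\<lambda>x. \<Sum>i\<in>UNIV. partial_deriv i (\<lambda>y. F y $ i) x * g x)"
    by (simp add: divergence_def sum_distrib_right)
  show "integrable torus_measure (\<lambda>x. divergence F x * g x)"
    unfolding d by (intro Bochner_Integration.integrable_sum int)
  show "(\<integral>x. divergence F x * g x \<partial>torus_measure) = - (\<integral>x. F x \<bullet> grad g x \<partial>torus_measure)"
    unfolding d
    by (simp add: int torus_by_parts[OF F g] inner_vec_def grad_def sum_negf)
qed

section \<open>A Nash inequality\<close>

text \<open>By Fubini and translation invariance, the average of the autocorrelation over all shifts factorises.\<close>

lemma integral_torus_autocorrelation:
  fixes f :: "real^'n \<Rightarrow> real"
  assumes f: "torus_C0 f"
  shows "(\<integral>h. (\<integral>x. f x * f (x + h) \<partial>torus_measure) \<partial>torus_measure) = (\<integral>x. f x \<partial>torus_measure)\<^sup>2"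
    and "integrable torus_measure (\<lambda>h. \<integral>x. f x * f (x + h) \<partial>torus_measure)"
proof -
  interpret T: prob_space "torus_measure :: (real^'n) measure" by (rule prob_space_torus)
  interpret P: pair_prob_space "torus_measure :: (real^'n) measure" "torus_measure :: (real^'n) measure" ..
  have cont: "continuous_on UNIV f" using f by (simp add: torus_C0_def)
  obtain B where B: "\<And>x. norm (f x) \<le> B"
    using periodic_continuous_bounded[of f] f by (auto simp: bounded_iff torus_C0_def)
  have "continuous_on UNIV (\<lambda>p. f (snd p))" "continuous_on UNIV (\<lambda>p. f (snd p + fst p))"
    by (rule continuous_on_compose2[OF cont]; auto intro!: continuous_intros)+
  then have "continuous_on UNIV (\<lambda>p. f (snd p) * f (snd p + fst p))"
    by (intro continuous_intros)
  then have "(\<lambda>p. f (snd p) * f (snd p + fst p)) \<in> borel_measurable (torus_measure \<Otimes>\<^sub>M torus_measure)"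
    by (intro borel_measurable_pair_continuous continuous_borel_torus continuous_on_id)
  moreover have "norm (f x * f y) \<le> B * B" for x y
    using mult_mono[OF B[of x] B[of y]] B[of x] by (simp add: abs_mult order_trans[OF abs_ge_zero])
  ultimately have int: "integrable (torus_measure \<Otimes>\<^sub>M torus_measure) (\<lambda>(h, x). f x * f (x + h))"
    by (intro P.integrable_const_bound[where B="B * B"]) (auto simp: case_prod_beta)
  show "integrable torus_measure (\<lambda>h. \<integral>x. f x * f (x + h) \<partial>torus_measure)"
    using P.integrable_fst[OF int] .
  have "(\<integral>h. (\<integral>x. f x * f (x + h) \<partial>torus_measure) \<partial>torus_measure)
      = (\<integral>x. (\<integral>h. f x * f (h + x) \<partial>torus_measure) \<partial>torus_measure)"
    using P.Fubini_integral[OF int] by (simp add: add.commute)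
  also have "\<dots> = (\<integral>x. f x * (\<integral>h. f h \<partial>torus_measure) \<partial>torus_measure)"
    using integral_torus_shift[of f] f by (simp add: torus_C0_def)
  also have "\<dots> = (\<integral>x. f x \<partial>torus_measure)\<^sup>2"
    by (simp add: power2_eq_square)
  finally show "(\<integral>h. (\<integral>x. f x * f (x + h) \<partial>torus_measure) \<partial>torus_measure) = (\<integral>x. f x \<partial>torus_measure)\<^sup>2" .
qed

text \<open>The increment \<open>f (x + h) - f x\<close> is the mean over the segment of the directional
  derivative, so its square is at most the mean of the squared directional derivative. Integrating
  over \<open>x\<close> removes the dependence on the position along the segment.\<close>

lemma integral_shift_diff_le:
  fixes f :: "real^'n \<Rightarrow> real"
  assumes f: "torus_C1 f"
  shows "(\<integral>x. (f (x + h) - f x)\<^sup>2 \<partial>torus_measure)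
     \<le> (norm h)\<^sup>2 * (\<integral>x. (norm (grad f x))\<^sup>2 \<partial>torus_measure)"
proof -
  interpret U: prob_space unit_interval by (rule prob_space_unit_interval)
  let ?g = "\<lambda>x. grad f x \<bullet> h"
  have g: "torus_C0 ?g" by (intro torus_C0_intros torus_C1_grad_C0 f)
  have g2: "torus_C0 (\<lambda>x. (?g x)\<^sup>2)" using g by (rule torus_C0_power)
  have pointwise: "(f (x + h) - f x)\<^sup>2 \<le> (\<integral>t. (?g (x + t *\<^sub>R h))\<^sup>2 \<partial>unit_interval)" for x
  proof -
    \<comment> \<open>Nonnegativity of the variance is the Cauchy-Schwarz inequality needed here.\<close>
    have "0 \<le> U.variance (\<lambda>t. ?g (x + t *\<^sub>R h))" by (rule U.variance_positive)
    also have "\<dots> = (\<integral>t. (?g (x + t *\<^sub>R h))\<^sup>2 \<partial>unit_interval) - (\<integral>t. ?g (x + t *\<^sub>R h) \<partial>unit_interval)\<^sup>2"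
      by (intro U.variance_eq integrable_unit_interval segment_continuous[OF g] segment_continuous[OF g2])
    also have "(\<integral>t. ?g (x + t *\<^sub>R h) \<partial>unit_interval) = f (x + h) - f x"
      by (rule integral_segment_grad[OF f])
    finally show ?thesis by simp
  qed
  have "(\<integral>x. (f (x + h) - f x)\<^sup>2 \<partial>torus_measure)
      \<le> (\<integral>x. (\<integral>t. (?g (x + t *\<^sub>R h))\<^sup>2 \<partial>unit_interval) \<partial>torus_measure)"
  proof (rule integral_mono)
    show "integrable torus_measure (\<lambda>x. (f (x + h) - f x)\<^sup>2)"
      by (intro torus_C0_integrable torus_C0_intros torus_C0_shift torus_C1_C0 f)
    show "integrable torus_measure (\<lambda>x. \<integral>t. (?g (x + t *\<^sub>R h))\<^sup>2 \<partial>unit_interval)"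
      using g2 integral_torus_segment_average(2)[of "\<lambda>x. (?g x)\<^sup>2" h] by (simp add: torus_C0_def)
  qed (rule pointwise)
  also have "\<dots> = (\<integral>x. (?g x)\<^sup>2 \<partial>torus_measure)"
    using g2 by (intro integral_torus_segment_average(1)[of "\<lambda>x. (?g x)\<^sup>2" h]) (auto simp: torus_C0_def)
  also have "\<dots> \<le> (\<integral>x. (norm h)\<^sup>2 * (norm (grad f x))\<^sup>2 \<partial>torus_measure)"
  proof (intro integral_mono torus_C0_integrable torus_C0_intros torus_C1_grad_C0 f)
    fix x
    have "\<bar>?g x\<bar> \<le> norm h * norm (grad f x)"
      using Cauchy_Schwarz_ineq2[of "grad f x" h] by (simp add: mult.commute)
    from power_mono[OF this, of 2]
    show "(?g x)\<^sup>2 \<le> (norm h)\<^sup>2 * (norm (grad f x))\<^sup>2" by (simp add: power_mult_distrib)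
  qed
  finally show ?thesis by simp
qed

text \<open>This replaces the Sobolev inequality in the iteration below. Expanding the square gives
  \<open>\<integral> f\<^sup>2 = \<integral> f (x) f (x + h) + \<integral> (f (x + h) - f x)\<^sup>2 / 2\<close> for every shift \<open>h\<close>. Average this
  over \<open>h\<close> in a cell \<open>S\<close> of side \<open>\<delta>\<close>. The second term is controlled by the gradient, since
  \<open>|h|\<^sup>2 \<le> d \<delta>\<^sup>2\<close>. In the first one, as \<open>f \<ge> 0\<close>, the integral over \<open>S\<close> may be enlarged to the
  whole torus at the price of the factor \<open>1 / \<delta>\<^sup>d\<close>, and then equals \<open>(\<integral> f)\<^sup>2\<close>.\<close>

lemma torus_nash_inequality:
  fixes f :: "real^'n \<Rightarrow> real" and \<delta> :: real
  assumes f: "torus_C1 f" and nonneg: "\<And>x. 0 \<le> f x" and \<delta>: "0 < \<delta>" "\<delta> \<le> 1"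
  shows "(\<integral>x. (f x)\<^sup>2 \<partial>torus_measure) \<le>
      (\<integral>x. f x \<partial>torus_measure)\<^sup>2 / \<delta> ^ CARD('n)
      + CARD('n) * \<delta>\<^sup>2 / 2 * (\<integral>x. (norm (grad f x))\<^sup>2 \<partial>torus_measure)"
proof -
  interpret T: prob_space "torus_measure :: (real^'n) measure" by (rule prob_space_torus)
  let ?I = "\<lambda>g. \<integral>x. g x \<partial>(torus_measure :: (real^'n) measure)"
  define G where "G = ?I (\<lambda>x. (norm (grad f x))\<^sup>2)"
  define c where "c = CARD('n) * \<delta>\<^sup>2 / 2 * G"
  define S where "S = {x :: real^'n. \<forall>i. 0 \<le> x $ i \<and> x $ i < \<delta>}"
  define R where "R = (\<lambda>h. ?I (\<lambda>x. f x * f (x + h)))"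
  note C0 = torus_C1_C0[OF f]
  have G: "0 \<le> G" unfolding G_def by (intro Bochner_Integration.integral_nonneg) simp
  have R0: "0 \<le> R h" for h
    unfolding R_def by (intro Bochner_Integration.integral_nonneg mult_nonneg_nonneg nonneg)
  have Sset: "S \<in> sets torus_measure"
    unfolding torus_measure_def S_def using \<delta>(2)
    by (subst sets_restrict_space_iff) (auto simp: borel_cell intro: less_le_trans)
  have Smeas: "measure torus_measure S = \<delta> ^ CARD('n)"
  proof -
    have "emeasure torus_measure S = ennreal (\<delta> ^ CARD('n))"
      unfolding torus_measure_def S_def using \<delta>
      by (subst emeasure_restrict_space) (auto simp: borel_cell emeasure_cell intro: less_le_trans)
    then show ?thesis using \<delta> by (simp add: measure_def)
  qed
  have Sint: "integrable torus_measure (indicator S :: _ \<Rightarrow> real)"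
    using Sset by (intro integrable_real_indicator) (simp_all add: less_top[symmetric])
  have key: "?I (\<lambda>x. (f x)\<^sup>2) \<le> R h + c" if h: "h \<in> S" for h
  proof -
    have "(norm h)\<^sup>2 = (\<Sum>i\<in>UNIV. (h $ i)\<^sup>2)"
      unfolding power2_norm_eq_inner by (simp add: inner_vec_def power2_eq_square)
    also have "\<dots> \<le> (\<Sum>i\<in>(UNIV :: 'n set). (\<delta>\<^sup>2 :: real))"
      using h by (intro sum_mono power_mono) (auto simp: S_def less_imp_le)
    finally have "(norm h)\<^sup>2 \<le> CARD('n) * \<delta>\<^sup>2" by simp
    then have *: "(norm h)\<^sup>2 * G \<le> CARD('n) * \<delta>\<^sup>2 * G" using G by (rule mult_right_mono)
    have "?I (\<lambda>x. (f (x + h) - f x)\<^sup>2) = ?I (\<lambda>x. ((f (x + h))\<^sup>2 + (f x)\<^sup>2) - 2 * (f x * f (x + h)))"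
      by (intro Bochner_Integration.integral_cong) (auto simp: power2_eq_square algebra_simps)
    also have "\<dots> = (?I (\<lambda>x. (f (x + h))\<^sup>2) + ?I (\<lambda>x. (f x)\<^sup>2)) - 2 * R h"
    proof -
      have "integrable torus_measure (\<lambda>x. (f (x + h))\<^sup>2)" "integrable torus_measure (\<lambda>x. (f x)\<^sup>2)"
        "integrable torus_measure (\<lambda>x. f x * f (x + h))"
        by (intro torus_C0_integrable torus_C0_intros torus_C0_shift[OF C0] C0)+
      then show ?thesis unfolding R_def by simp
    qed
    also have "?I (\<lambda>x. (f (x + h))\<^sup>2) = ?I (\<lambda>x. (f x)\<^sup>2)"
      using torus_C0_power[OF C0, of 2] unfolding torus_C0_def
      by (intro integral_torus_shift[of "\<lambda>x. (f x)\<^sup>2" h]) auto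
    finally have "2 * ?I (\<lambda>x. (f x)\<^sup>2) - 2 * R h \<le> (norm h)\<^sup>2 * G"
      using integral_shift_diff_le[OF f, of h] unfolding G_def by simp
    then show ?thesis using * unfolding c_def by simp
  qed
  have "\<delta> ^ CARD('n) * ?I (\<lambda>x. (f x)\<^sup>2) = ?I (\<lambda>h. indicator S h * ?I (\<lambda>x. (f x)\<^sup>2))"
    using Sset by (simp add: Smeas)
  also have "\<dots> \<le> ?I (\<lambda>h. R h + indicator S h * c)"
  proof (rule integral_mono)
    show "integrable torus_measure (\<lambda>h. indicator S h * ?I (\<lambda>x. (f x)\<^sup>2))"
      "integrable torus_measure (\<lambda>h. R h + indicator S h * c)"
      using Sint integral_torus_autocorrelation(2)[OF C0] unfolding R_def by simp_all
  qed (use key R0 in \<open>auto simp: indicator_def\<close>)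
  also have "\<dots> = (?I f)\<^sup>2 + \<delta> ^ CARD('n) * c"
    using Sset Sint integral_torus_autocorrelation[OF C0] unfolding R_def by (simp add: Smeas)
  finally show ?thesis
    using \<delta> by (simp add: field_simps c_def G_def)
qed

section \<open>The one-sided bound on the Laplacian of the value function\<close>

text \<open>A periodic function attains its minimum, and there the first and second order conditions
  hold along every coordinate axis.\<close>

lemma torus_minimum:
  fixes u :: "real^'n \<Rightarrow> real"
  assumes per: "torus_periodic u" and C2: "Ck_on 2 u UNIV"
  obtains x where "\<And>y. u x \<le> u y" "grad u x = 0" "0 \<le> laplacian u x"
proof -
  have u: "torus_C1 u" and p: "torus_C1 (\<lambda>y. grad u y $ i)" for i
    using C2 torus_C1_Ck[OF per, of 1] torus_C1_partial_Ck[OF per, of 0]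
    by (simp_all add: numeral_2_eq_2)
  have "continuous_on (cbox 0 1) u"
    using torus_C1_C0[OF u] by (auto simp: torus_C0_def intro: continuous_on_subset)
  moreover have "(0 :: real^'n) \<in> cbox 0 1" by (simp add: mem_box_cart)
  ultimately obtain x where "\<forall>y\<in>cbox 0 1. u x \<le> u y"
    using continuous_attains_inf[of "cbox 0 1" u] compact_cbox by (metis empty_iff)
  then have min: "u x \<le> u y" for y
    using torus_periodic_range[OF per] by (metis imageE rangeI)
  have crit: "grad u x $ i = 0 \<and> 0 \<le> partial_deriv i (\<lambda>y. grad u y $ i) x" for i
  proof -
    let ?e = "axis i 1 :: real^'n"
    let ?g = "\<lambda>t. u (x + t *\<^sub>R ?e)" and ?g' = "\<lambda>t. grad u (x + t *\<^sub>R ?e) $ i"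
    have g: "(?g has_real_derivative ?g' t) (at t)" for t
      using DERIV_segment[OF u, of x ?e t] by (simp add: inner_axis)
    have g'': "(?g' has_real_derivative partial_deriv i (\<lambda>y. grad u y $ i) x) (at 0)"
      using DERIV_segment[OF p[of i], of x ?e 0] by (simp add: inner_axis grad_def[of "\<lambda>y. grad u y $ i"])
    have zero: "?g' 0 = 0"
      by (rule DERIV_local_min[OF g, of 1]) (auto simp: min)
    have "0 \<le> partial_deriv i (\<lambda>y. grad u y $ i) x"
    \<comment> \<open>A negative second derivative would make \<open>u\<close> strictly decreasing to the right of its minimum.\<close>
    proof (rule ccontr)
      assume "\<not> ?thesis"
      then obtain d where d: "0 < d" "\<And>t. 0 < t \<Longrightarrow> t < d \<Longrightarrow> ?g' t < 0"
        using DERIV_neg_dec_right[OF g''] zero by auto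
      obtain z where z: "0 < z" "z < d / 2" "?g (d / 2) - ?g 0 = (d / 2 - 0) * ?g' z"
        using MVT2[of 0 "d/2" ?g ?g'] g d(1) by auto
      have "?g (d / 2) < ?g 0"
        using d(2)[of z] z d(1) mult_pos_neg[of "d/2" "?g' z"] by auto
      then show False using min by (simp add: not_less[symmetric])
    qed
    with zero show ?thesis by simp
  qed
  have "partial_deriv i u = (\<lambda>y. grad u y $ i)" for i by (simp add: grad_def fun_eq_iff)
  then have "0 \<le> laplacian u x"
    unfolding laplacian_def using crit by (intro sum_nonneg) simp
  moreover have "grad u x = 0" using crit by (simp add: vec_eq_iff)
  ultimately show thesis using min that by blast
qed

lemma norm_le_sup_norm_on:
  "bounded (f ` S) \<Longrightarrow> x \<in> S \<Longrightarrow> norm (f x) \<le> sup_norm_on S f"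
  unfolding sup_norm_on_def by (rule cSUP_upper) (auto simp: bounded_iff bdd_above_def)

lemma laplacian_eq_divergence: "laplacian f = divergence (grad f)"
  by (simp add: fun_eq_iff laplacian_def divergence_def grad_def)

lemma drift_C0: "drift_assms b \<Longrightarrow> torus_C0 b"
  by (auto simp: drift_assms_def torus_C0_def Cinf_on_def intro: Ck_on_continuous)

lemma drift_component_C1:
  assumes "drift_assms b"
  shows "torus_C1 (\<lambda>y. b y $ i)"
proof (rule torus_C1I(1))
  have Ck: "Ck_on (Suc 0) b UNIV" using assms by (auto simp: drift_assms_def Cinf_on_def)
  show "torus_periodic (\<lambda>y. b y $ i)"
    using assms by (simp add: drift_assms_def torus_periodic_def)
  show "GDERIV (\<lambda>y. b y $ i) x :> grad (\<lambda>y. b y $ i) x" for x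
    using Ck differentiable_chain_at[of b x "\<lambda>z. z $ i"]
    by (intro GDERIV_grad) (simp add: comp_def bounded_linear_imp_differentiable bounded_linear_vec_nth)
  have "grad (\<lambda>y. b y $ i) = (\<lambda>x. \<chi> j. dir_deriv (axis j 1) b x $ i)"
  proof
    fix x
    have "(b has_derivative frechet_derivative b (at x)) (at x)"
      using Ck by (simp add: frechet_derivative_works)
    from bounded_linear.has_derivative[OF bounded_linear_vec_nth this, of i]
    show "grad (\<lambda>y. b y $ i) x = (\<chi> j. dir_deriv (axis j 1) b x $ i)"
      by (simp add: vec_eq_iff grad_def partial_deriv_def dir_deriv_eq) (simp add: dir_deriv_def)
  qed
  moreover have "continuous_on UNIV (\<lambda>x. \<chi> j. dir_deriv (axis j 1) b x $ i)"
    using Ck by (auto intro!: continuous_on_vec_lambda continuous_on_component)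
  ultimately show "continuous_on UNIV (grad (\<lambda>y. b y $ i))" by (simp only:)
qed

lemma drift_bound: "drift_assms b \<Longrightarrow> norm (b x) \<le> sup_norm_on UNIV b"
  using drift_C0[of b] unfolding torus_C0_def
  by (intro norm_le_sup_norm_on periodic_continuous_bounded) auto

lemma potential_bound:
  assumes "potential_assms V" "0 < r"
  shows "\<bar>V (x, r)\<bar> \<le> sup_norm_on (UNIV \<times> {0<..}) V"
proof -
  have "bounded (V ` (UNIV \<times> {0<..}))"
    using assms(1) unfolding potential_assms_def bounded_derivs_on_def
    by (metis empty_subsetI iter_deriv.simps(1) list.set(1))
  then show ?thesis using norm_le_sup_norm_on[of V _ "(x, r)"] assms(2) by simp
qed

lemma classical_solution_regularity:
  assumes "classical_solution \<alpha> V b u m"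
  shows "0 < m x" "torus_C1 u" "torus_C1 m"
    "torus_C1 (\<lambda>y. grad u y $ i)" "torus_C1 (\<lambda>y. grad m y $ i)"
  using assms torus_C1_Ck[of u 1] torus_C1_partial_Ck[of u 0]
    torus_C1_Ck[of m 1] torus_C1_partial_Ck[of m 0]
  by (simp_all add: numeral_2_eq_2 classical_solution_def)

text \<open>All the information about \<open>u\<close> that is needed is this one-sided bound. At a minimum of
  \<open>u\<close> the gradient terms vanish and \<open>\<Delta> u \<ge> 0\<close>, whence \<open>u \<ge> - \<nu>\<close>. The first equation then gives
  \<open>- \<Delta> u \<le> 2 \<nu> - |Du|\<^sup>2 / (2 m\<^sup>\<alpha>) - b \<bullet> Du\<close>, and completing the square in \<open>Du\<close> leaves
  \<open>\<beta>\<^sup>2 m\<^sup>\<alpha> / 2\<close> at most.\<close>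

lemma hamilton_jacobi_laplacian_bound:
  fixes u m :: "real^'n \<Rightarrow> real"
  assumes V: "potential_assms V" and b: "drift_assms b" and sol: "classical_solution \<alpha> V b u m"
  defines "\<beta> \<equiv> sup_norm_on UNIV b" and "\<nu> \<equiv> sup_norm_on (UNIV \<times> {0<..}) V"
  shows "- laplacian u x \<le> 2 * \<nu> + \<beta>\<^sup>2 / 2 * m x powr \<alpha>"
proof -
  note m = classical_solution_regularity(1)[OF sol]
  have HJ: "u y - laplacian u y + (norm (grad u y))\<^sup>2 / (2 * m y powr \<alpha>) + b y \<bullet> grad u y = V (y, m y)" for y
    using sol by (simp add: classical_solution_def)
  have V: "\<bar>V (y, m y)\<bar> \<le> \<nu>" for y
    unfolding \<nu>_def by (rule potential_bound[OF V m])
  have \<beta>: "norm (b y) \<le> \<beta>" for y unfolding \<beta>_def by (rule drift_bound[OF b])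
  obtain z where z: "\<And>y. u z \<le> u y" "grad u z = 0" "0 \<le> laplacian u z"
    using sol by (auto simp: classical_solution_def intro: torus_minimum[of u])
  have "- \<nu> \<le> u z" using HJ[of z] z V[of z] by simp
  then have u: "- \<nu> \<le> u x" using z(1)[of x] by simp
  let ?A = "m x powr \<alpha>" and ?g = "norm (grad u x)"
  have A: "0 < ?A" using m[of x] by simp
  have "- (b x \<bullet> grad u x) \<le> norm (b x) * ?g"
    using Cauchy_Schwarz_ineq2[of "b x" "grad u x"] by linarith
  also have "\<dots> \<le> \<beta> * ?g" using \<beta> by (intro mult_right_mono) auto
  also have "\<dots> \<le> ?g\<^sup>2 / (2 * ?A) + \<beta>\<^sup>2 / 2 * ?A"
  proof -
    have "0 \<le> (?g - \<beta> * ?A)\<^sup>2 / (2 * ?A)" using A by simp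
    also have "\<dots> = ?g\<^sup>2 / (2 * ?A) + \<beta>\<^sup>2 / 2 * ?A - \<beta> * ?g"
      using A by (simp add: field_simps power2_eq_square)
    finally show ?thesis by simp
  qed
  finally show ?thesis using HJ[of x] V[of x] u by linarith
qed

section \<open>The energy estimate for negative powers of the density\<close>

text \<open>A form of Young's inequality that lets \<open>w\<^sup>\<alpha>\<close>, with \<open>w = 1 / m\<close>, be absorbed into
  the better power \<open>w\<close>. This is where \<open>\<alpha> < 1\<close> enters.\<close>

lemma powr_absorb:
  fixes c w \<alpha> :: real
  assumes "0 \<le> \<alpha>" "\<alpha> < 1" "0 \<le> c" "0 < w"
  shows "c * w powr \<alpha> \<le> w + c powr (1 / (1 - \<alpha>))"
proof (cases "c \<le> w powr (1 - \<alpha>)")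
  case True
  then have "c * w powr \<alpha> \<le> w powr (1 - \<alpha>) * w powr \<alpha>" by (intro mult_right_mono) auto
  also have "\<dots> = w" using assms by (simp add: powr_add[symmetric])
  finally show ?thesis using powr_ge_zero[of c "1 / (1 - \<alpha>)"] by linarith
next
  case False
  then have c: "0 < c" using assms by (smt (verit) powr_ge_zero)
  have "w = (w powr (1 - \<alpha>)) powr (1 / (1 - \<alpha>))" using assms by (simp add: powr_powr)
  also have "\<dots> \<le> c powr (1 / (1 - \<alpha>))" using False assms by (intro powr_mono2) auto
  finally have "w powr \<alpha> \<le> (c powr (1 / (1 - \<alpha>))) powr \<alpha>" using assms by (intro powr_mono2) auto
  then have "c * w powr \<alpha> \<le> c powr 1 * c powr (\<alpha> / (1 - \<alpha>))" using c by (simp add: powr_powr)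
  also have "\<dots> = c powr (1 + \<alpha> / (1 - \<alpha>))" by (simp only: powr_add)
  also have "1 + \<alpha> / (1 - \<alpha>) = 1 / (1 - \<alpha>)" using assms by (simp add: field_simps)
  finally show ?thesis using assms by (simp add: add_increasing)
qed

definition energy_const :: "real \<Rightarrow> real \<Rightarrow> real \<Rightarrow> real" where
  "energy_const \<alpha> \<beta> \<nu> = 1 + 3 * \<beta>\<^sup>2 + (6 * \<nu>) powr (1 / (1 - \<alpha>))"

lemma energy_const_ge_1: "1 \<le> energy_const \<alpha> \<beta> \<nu>"
  by (simp add: energy_const_def add_nonneg_nonneg)

text \<open>Put \<open>q = 2 p + 1\<close> and \<open>s = q - 1 + \<alpha>\<close>, and test the second equation with \<open>m\<^sup>-\<^sup>q\<close>. The
  congestion term produces \<open>m\<^sup>1\<^sup>-\<^sup>\<alpha> Du \<bullet> D (m\<^sup>-\<^sup>q) = (q / s) Du \<bullet> D (m\<^sup>-\<^sup>s)\<close>; the exponent \<open>s\<close> is chosen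
  for this identity. Its integral is \<open>(q / s) \<integral> (- \<Delta> u) m\<^sup>-\<^sup>s\<close>, to which the one-sided bound on
  \<open>- \<Delta> u\<close> applies, so that no estimate on \<open>Du\<close> is required. The drift is split by Young's
  inequality between the Dirichlet term and \<open>\<integral> m\<^sup>1\<^sup>-\<^sup>q\<close>; no derivative of \<open>b\<close> appears since the
  divergence has been moved to the test function. The term \<open>\<integral> m\<^sup>-\<^sup>s\<close> has too large an exponent for
  the right hand side and is absorbed into half of \<open>\<integral> m\<^sup>-\<^sup>q\<close>. The resulting constant grows only
  linearly in \<open>p\<close>.\<close>

lemma energy_estimate:
  fixes u m :: "real^'n \<Rightarrow> real"
  assumes \<alpha>: "0 \<le> \<alpha>" "\<alpha> < 1"
    and V: "potential_assms V" and b: "drift_assms b" and sol: "classical_solution \<alpha> V b u m"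
    and p: "1 \<le> p"
  defines "\<beta> \<equiv> sup_norm_on UNIV b" and "\<nu> \<equiv> sup_norm_on (UNIV \<times> {0<..}) V"
  defines "K \<equiv> energy_const \<alpha> \<beta> \<nu>"
  shows "(\<integral>x. m x powr (- 2 * p - 1) \<partial>torus_measure) / 2
      + (p + 1/2) * (\<integral>x. m x powr (- 2 * p - 2) * (norm (grad m x))\<^sup>2 \<partial>torus_measure)
      \<le> K * p * (\<integral>x. m x powr (- 2 * p) \<partial>torus_measure)"
proof -
  let ?I = "\<lambda>g. \<integral>x. g x \<partial>(torus_measure :: (real^'n) measure)"
  note reg = classical_solution_regularity[OF sol]
  note pos = reg(1) and u1 = reg(2) and m1 = reg(3) and u2 = reg(4) and m2 = reg(5)
  note b0 = drift_C0[OF b]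
  have \<beta>: "norm (b y) \<le> \<beta>" for y unfolding \<beta>_def by (rule drift_bound[OF b])
  have \<nu>: "0 \<le> \<nu>"
    using potential_bound[OF V, of 1 0] abs_ge_zero[of "V (0, 1)"] unfolding \<nu>_def by linarith
  note C0 = torus_C0_intros torus_C0_powr[OF _ pos] torus_C1_C0[OF m1] torus_C1_grad_C0[OF m1]
    torus_C1_grad_C0[OF u1] b0
  define q s where "q = 2 * p + 1" and "s = 2 * p + \<alpha>"
  \<comment> \<open>In terms of these integrals, testing the second equation gives
    \<open>A - q E - q X - q Y = P\<close>, where \<open>X\<close> carries the congestion term and \<open>Y\<close> the drift.\<close>
  define A where "A = ?I (\<lambda>x. m x powr (1 - q))"
  define E where "E = ?I (\<lambda>x. m x powr (- q - 1) * (norm (grad m x))\<^sup>2)"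
  define X where "X = ?I (\<lambda>x. m x powr (- s - 1) * (grad u x \<bullet> grad m x))"
  define Y where "Y = ?I (\<lambda>x. m x powr (- q) * (b x \<bullet> grad m x))"
  define P where "P = ?I (\<lambda>x. m x powr (- q))"
  define Z where "Z = ?I (\<lambda>x. m x powr (- s))"
  have int: "integrable torus_measure (\<lambda>x. m x powr r)"
    "integrable torus_measure (\<lambda>x. m x powr r * (norm (grad m x))\<^sup>2)"
    "integrable torus_measure (\<lambda>x. m x powr r * (b x \<bullet> grad m x))" for r
    by (intro torus_C0_integrable C0)+
  have A0: "0 \<le> A" and Z0: "0 \<le> Z" unfolding A_def Z_def
    by (intro Bochner_Integration.integral_nonneg; simp)+
  have pows: "m x powr r * m x powr t = m x powr (r + t)" "m x * m x powr r = m x powr (1 + r)" for x r t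
    using pos[of x] by (simp_all add: powr_add)
  have X: "- s * X \<le> 2 * \<nu> * Z + \<beta>\<^sup>2 / 2 * A"
  proof -
    note \<psi> = torus_C1_powr[OF m1 pos, of "- s"]
    note div = torus_divergence_theorem[OF u2 \<psi>(1)]
    have "?I (\<lambda>x. divergence (grad u) x * m x powr (- s))
        = - ?I (\<lambda>x. - s * (m x powr (- s - 1) * (grad u x \<bullet> grad m x)))"
      unfolding div(1) \<psi>(2) by (simp add: mult.assoc)
    then have "- s * X = ?I (\<lambda>x. - (divergence (grad u) x * m x powr (- s)))"
      unfolding X_def by simp
    also have "\<dots> \<le> ?I (\<lambda>x. 2 * \<nu> * m x powr (- s) + \<beta>\<^sup>2 / 2 * m x powr (1 - q))"
    proof (rule integral_mono)
      fix x
      have "- laplacian u x * m x powr (- s) \<le> (2 * \<nu> + \<beta>\<^sup>2 / 2 * m x powr \<alpha>) * m x powr (- s)"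
        unfolding \<beta>_def \<nu>_def
        by (intro mult_right_mono hamilton_jacobi_laplacian_bound[OF V b sol]) simp
      also have "\<dots> = 2 * \<nu> * m x powr (- s) + \<beta>\<^sup>2 / 2 * m x powr (1 - q)"
        by (simp add: distrib_right mult.assoc pows q_def s_def)
      finally show "- (divergence (grad u) x * m x powr (- s))
          \<le> 2 * \<nu> * m x powr (- s) + \<beta>\<^sup>2 / 2 * m x powr (1 - q)"
        by (simp add: laplacian_eq_divergence)
    qed (use div(2) int(1) in auto)
    also have "\<dots> = 2 * \<nu> * Z + \<beta>\<^sup>2 / 2 * A"
      using int(1) unfolding Z_def A_def by simp
    finally show ?thesis .
  qed
  have FP: "A - q * E - q * X - q * Y = P"
  proof -
    note \<phi> = torus_C1_powr[OF m1 pos, of "- q"]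
    let ?\<phi> = "\<lambda>x. m x powr (- q)"
    let ?F = "\<lambda>y. m y powr (1 - \<alpha>) *\<^sub>R grad u y" and ?B = "\<lambda>y. m y *\<^sub>R b y"
    have F: "torus_C1 (\<lambda>y. ?F y $ i)" and B: "torus_C1 (\<lambda>y. ?B y $ i)" for i
      using torus_C1_mult(1)[OF torus_C1_powr(1)[OF m1 pos] u2, of "1 - \<alpha>" i]
        torus_C1_mult(1)[OF m1 drift_component_C1[OF b, of i]] by simp_all
    note div = torus_divergence_theorem[OF m2 \<phi>(1)] torus_divergence_theorem[OF F \<phi>(1)]
      torus_divergence_theorem[OF B \<phi>(1)]
    have 1: "?I (\<lambda>x. divergence (grad m) x * ?\<phi> x) = q * E"
    proof -
      have "?I (\<lambda>x. divergence (grad m) x * ?\<phi> x)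
          = - ?I (\<lambda>x. - q * (m x powr (- q - 1) * (norm (grad m x))\<^sup>2))"
        unfolding div(1) \<phi>(2) by (simp add: mult.assoc power2_norm_eq_inner)
      then show ?thesis unfolding E_def by simp
    qed
    have 2: "?I (\<lambda>x. divergence ?F x * ?\<phi> x) = q * X"
    proof -
      have "?F x \<bullet> ((- q * m x powr (- q - 1)) *\<^sub>R grad m x)
          = - q * (m x powr (- s - 1) * (grad u x \<bullet> grad m x))" for x
      proof -
        have "m x powr (1 - \<alpha>) * m x powr (- q - 1) = m x powr (- s - 1)"
          unfolding pows by (rule arg_cong[where f="(powr) (m x)"]) (simp add: q_def s_def)
        then show ?thesis by (simp add: mult.assoc mult.left_commute)
      qed
      then have "?I (\<lambda>x. divergence ?F x * ?\<phi> x)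
          = - ?I (\<lambda>x. - q * (m x powr (- s - 1) * (grad u x \<bullet> grad m x)))"
        unfolding div(3) \<phi>(2) by (simp only:)
      then show ?thesis unfolding X_def by simp
    qed
    have 3: "?I (\<lambda>x. divergence ?B x * ?\<phi> x) = q * Y"
    proof -
      have "?B x \<bullet> ((- q * m x powr (- q - 1)) *\<^sub>R grad m x)
          = - q * (m x powr (- q) * (b x \<bullet> grad m x))" for x
      proof -
        have "m x * m x powr (- q - 1) = m x powr (- q)"
          unfolding pows by simp
        then show ?thesis by (simp add: mult.assoc mult.left_commute)
      qed
      then have "?I (\<lambda>x. divergence ?B x * ?\<phi> x)
          = - ?I (\<lambda>x. - q * (m x powr (- q) * (b x \<bullet> grad m x)))"
        unfolding div(5) \<phi>(2) by (simp only:)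
      then show ?thesis unfolding Y_def by simp
    qed
    have "m x powr (1 - q) - divergence (grad m) x * ?\<phi> x - divergence ?F x * ?\<phi> x
        - divergence ?B x * ?\<phi> x = ?\<phi> x" for x
    proof -
      have "m x - divergence (grad m) x - divergence ?F x - divergence ?B x = 1"
        using sol unfolding classical_solution_def laplacian_eq_divergence by blast
      from arg_cong[OF this, of "\<lambda>r. r * ?\<phi> x"] show ?thesis
        by (simp add: left_diff_distrib pows)
    qed
    then have "P = ?I (\<lambda>x. m x powr (1 - q) - divergence (grad m) x * ?\<phi> x - divergence ?F x * ?\<phi> x
        - divergence ?B x * ?\<phi> x)"
      unfolding P_def by simp
    also have "\<dots> = A - q * E - q * X - q * Y"
      unfolding 1[symmetric] 2[symmetric] 3[symmetric] A_def using int(1) div(2,4,6) by simp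
    finally show ?thesis by simp
  qed
  have Y: "- Y \<le> E / 2 + \<beta>\<^sup>2 / 2 * A"
  proof -
    have "- Y = ?I (\<lambda>x. - (m x powr (- q) * (b x \<bullet> grad m x)))"
      unfolding Y_def by simp
    also have "\<dots> \<le> ?I (\<lambda>x. m x powr (- q - 1) * (norm (grad m x))\<^sup>2 / 2 + \<beta>\<^sup>2 / 2 * m x powr (1 - q))"
    proof (rule integral_mono)
      fix x
      let ?g = "norm (grad m x)"
      have "- (b x \<bullet> grad m x) \<le> norm (b x) * ?g"
        using Cauchy_Schwarz_ineq2[of "b x" "grad m x"] by linarith
      also have "\<dots> \<le> \<beta> * ?g" using \<beta> by (intro mult_right_mono) auto
      finally have "m x * - (b x \<bullet> grad m x) \<le> m x * (\<beta> * ?g)"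
        using pos[of x] by (intro mult_left_mono) auto
      also have "\<dots> \<le> ?g\<^sup>2 / 2 + \<beta>\<^sup>2 / 2 * (m x)\<^sup>2"
        using zero_le_power2[of "?g - \<beta> * m x"] by (simp add: power2_eq_square algebra_simps)
      finally have "m x powr (- q - 1) * (m x * - (b x \<bullet> grad m x))
          \<le> m x powr (- q - 1) * (?g\<^sup>2 / 2 + \<beta>\<^sup>2 / 2 * (m x)\<^sup>2)"
        by (rule mult_left_mono) simp
      moreover have "m x powr (- q - 1) * (m x * - (b x \<bullet> grad m x)) = - (m x powr (- q) * (b x \<bullet> grad m x))"
        using pows(2)[of x "- q - 1"] by (simp add: mult.commute[of "m x powr (- q - 1)" "m x"] flip: mult.assoc)
      moreover have "m x powr (- q - 1) * (m x)\<^sup>2 = m x powr (1 - q)"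
      proof -
        have "m x powr (- q - 1) * (m x)\<^sup>2 = m x * (m x * m x powr (- q - 1))"
          by (simp add: power2_eq_square)
        then show ?thesis unfolding pows by simp
      qed
      then have "m x powr (- q - 1) * (?g\<^sup>2 / 2 + \<beta>\<^sup>2 / 2 * (m x)\<^sup>2)
          = m x powr (- q - 1) * ?g\<^sup>2 / 2 + \<beta>\<^sup>2 / 2 * m x powr (1 - q)"
        by (simp add: distrib_left)
      ultimately show "- (m x powr (- q) * (b x \<bullet> grad m x))
          \<le> m x powr (- q - 1) * ?g\<^sup>2 / 2 + \<beta>\<^sup>2 / 2 * m x powr (1 - q)"
        by linarith
    qed (use int in auto)
    also have "\<dots> = E / 2 + \<beta>\<^sup>2 / 2 * A"
      using int unfolding E_def A_def by simp
    finally show ?thesis .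
  qed
  define c where "c = (6 * \<nu>) powr (1 / (1 - \<alpha>))"
  have c: "0 \<le> c" by (simp add: c_def)
  have Z: "6 * \<nu> * Z \<le> P + c * A"
  proof -
    have "6 * \<nu> * Z = ?I (\<lambda>x. 6 * \<nu> * m x powr (- s))" unfolding Z_def by simp
    also have "\<dots> \<le> ?I (\<lambda>x. m x powr (- q) + c * m x powr (1 - q))"
    proof (rule integral_mono)
      fix x
      have "6 * \<nu> * (m x powr (-1)) powr \<alpha> \<le> m x powr (-1) + c"
        unfolding c_def using \<nu> \<alpha> pos[of x] by (intro powr_absorb) auto
      from mult_right_mono[OF this, of "m x powr (1 - q)"]
      have "6 * \<nu> * ((m x powr (-1)) powr \<alpha> * m x powr (1 - q))
          \<le> m x powr (-1) * m x powr (1 - q) + c * m x powr (1 - q)"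
        by (simp only: distrib_right mult.assoc powr_ge_zero)
      moreover have "(-1) * \<alpha> + (1 - q) = - s" "-1 + (1 - q) = - q" by (simp_all add: q_def s_def)
      ultimately show "6 * \<nu> * m x powr (- s) \<le> m x powr (- q) + c * m x powr (1 - q)"
        by (simp only: powr_powr pows)
    qed (use int in auto)
    also have "\<dots> = P + c * A" using int unfolding P_def A_def by simp
    finally show ?thesis .
  qed
  have qX: "- q * X \<le> 3/2 * (2 * \<nu> * Z + \<beta>\<^sup>2 / 2 * A)"
  proof -
    \<comment> \<open>Here \<open>p \<ge> 1\<close> gives \<open>q / s \<le> (2 p + 1) / (2 p) \<le> 3 / 2\<close>.\<close>
    have s: "0 < s" and qs: "q / s \<le> 3/2" using p \<alpha> by (auto simp: q_def s_def field_simps)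
    have "- q * X = q / s * (- s * X)" using s by simp
    also have "\<dots> \<le> q / s * (2 * \<nu> * Z + \<beta>\<^sup>2 / 2 * A)"
      using s p X by (intro mult_left_mono) (auto simp: q_def)
    also have "\<dots> \<le> 3/2 * (2 * \<nu> * Z + \<beta>\<^sup>2 / 2 * A)"
      using qs \<nu> Z0 A0 by (intro mult_right_mono) auto
    finally show ?thesis .
  qed
  have qY: "- q * Y \<le> q * (E / 2 + \<beta>\<^sup>2 / 2 * A)"
  proof -
    have "0 \<le> q" using p by (simp add: q_def)
    from mult_left_mono[OF Y this] show ?thesis by simp
  qed
  have "P / 2 + q / 2 * E \<le> (1 + c / 2 + 3/4 * \<beta>\<^sup>2 + q / 2 * \<beta>\<^sup>2) * A"
    using eq_refl[OF FP[symmetric]] qX qY Z by (simp add: algebra_simps)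
  also have "\<dots> \<le> K * p * A"
  proof (rule mult_right_mono[OF _ A0])
    have K: "K = 1 + 3 * \<beta>\<^sup>2 + c" by (simp add: K_def energy_const_def c_def)
    have "c * 1 \<le> c * p" "\<beta>\<^sup>2 * 1 \<le> \<beta>\<^sup>2 * p" using p c by (intro mult_left_mono; simp)+
    moreover have "K * p = p + 3 * (\<beta>\<^sup>2 * p) + c * p" unfolding K by algebra
    moreover have "q / 2 * \<beta>\<^sup>2 = \<beta>\<^sup>2 * p + \<beta>\<^sup>2 / 2" unfolding q_def by (simp add: field_simps)
    moreover have "1 + c / 2 + 3/4 * e + (ep + e / 2) \<le> p + 3 * ep + cp"
      if "c * 1 \<le> cp" "e * 1 \<le> ep" "0 \<le> e" for e ep cp :: real
      using that p c by linarith
    ultimately show "1 + c / 2 + 3/4 * \<beta>\<^sup>2 + q / 2 * \<beta>\<^sup>2 \<le> K * p"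
      by (metis zero_le_power2)
  qed
  finally have "P / 2 + q / 2 * E \<le> K * p * A" .
  moreover have "- q = - 2 * p - 1" "- q - 1 = - 2 * p - 2" "1 - q = - 2 * p" "q / 2 = p + 1/2"
    by (simp_all add: q_def)
  ultimately show ?thesis unfolding P_def E_def A_def by (simp only:)
qed

section \<open>Moser iteration\<close>

definition doubling_const :: "nat \<Rightarrow> real \<Rightarrow> real" where
  "doubling_const d K = 2 * sqrt (d * K) ^ d"

text \<open>Nash's inequality for \<open>f = m\<^sup>-\<^sup>p\<close>. The energy estimate says that
  \<open>\<integral> |Df|\<^sup>2 \<le> K p\<^sup>2 \<integral> f\<^sup>2\<close>, hence for \<open>\<delta> = 1 / (p sqrt (d K))\<close> the gradient term is at most half of
  the left hand side, and \<open>\<integral> f\<^sup>2\<close> is bounded by \<open>(\<integral> f)\<^sup>2\<close> with a constant that is polynomial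
  in \<open>p\<close>.\<close>

lemma moment_doubling:
  fixes u m :: "real^'n \<Rightarrow> real"
  assumes \<alpha>: "0 \<le> \<alpha>" "\<alpha> < 1"
    and V: "potential_assms V" and b: "drift_assms b" and sol: "classical_solution \<alpha> V b u m"
    and p: "1 \<le> p"
  defines "\<beta> \<equiv> sup_norm_on UNIV b" and "\<nu> \<equiv> sup_norm_on (UNIV \<times> {0<..}) V"
  defines "K \<equiv> energy_const \<alpha> \<beta> \<nu>"
  shows "(\<integral>x. m x powr (- 2 * p) \<partial>torus_measure)
    \<le> doubling_const CARD('n) K * p ^ CARD('n) * (\<integral>x. m x powr (- p) \<partial>torus_measure)\<^sup>2"
proof -
  let ?I = "\<lambda>g. \<integral>x. g x \<partial>(torus_measure :: (real^'n) measure)"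
  let ?d = "CARD('n)"
  define A where "A = ?I (\<lambda>x. m x powr (- 2 * p))"
  define E where "E = ?I (\<lambda>x. m x powr (- 2 * p - 2) * (norm (grad m x))\<^sup>2)"
  note pos = classical_solution_regularity(1)[OF sol]
  have m1: "torus_C1 m" by (rule classical_solution_regularity(3)[OF sol])
  note f = torus_C1_powr[OF m1 pos, of "- p"]
  have E0: "0 \<le> E" and P0: "0 \<le> ?I (\<lambda>x. m x powr (- 2 * p - 1))"
    unfolding E_def by (intro Bochner_Integration.integral_nonneg; simp)+
  have "p * E \<le> (p + 1/2) * E" using E0 by (simp add: algebra_simps)
  also have "\<dots> \<le> K * p * A"
    using energy_estimate[OF \<alpha> V b sol p] P0 unfolding A_def E_def K_def \<beta>_def \<nu>_def by linarith
  finally have EA: "E \<le> K * A" using p by (simp add: mult.commute mult.left_commute)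
  have K: "1 \<le> K" unfolding K_def by (rule energy_const_ge_1)
  define \<kappa> where "\<kappa> = sqrt (?d * K)"
  have "1 * 1 \<le> ?d * K" using K by (intro mult_mono) (auto simp: Suc_le_eq)
  then have \<kappa>: "1 \<le> \<kappa>" "\<kappa>\<^sup>2 = ?d * K" using K by (auto simp: \<kappa>_def)
  define \<delta> where "\<delta> = 1 / (p * \<kappa>)"
  have p\<kappa>: "1 \<le> p * \<kappa>" using mult_mono[of 1 p 1 \<kappa>] p \<kappa> by simp
  then have \<delta>: "0 < \<delta>" "\<delta> \<le> 1" by (auto simp: \<delta>_def)
  have sq: "(m x powr (- p))\<^sup>2 = m x powr (- 2 * p)" for x
    using pos[of x] by (simp add: power2_eq_square flip: powr_add)
  have grad2: "(norm (grad (\<lambda>x. m x powr (- p)) x))\<^sup>2 = p\<^sup>2 * (m x powr (- 2 * p - 2) * (norm (grad m x))\<^sup>2)" for x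
  proof -
    have "(m x powr (- p - 1))\<^sup>2 = m x powr (- 2 * p - 2)"
      using pos[of x] by (simp add: power2_eq_square flip: powr_add)
    then show ?thesis unfolding f(2) by (simp add: power_mult_distrib)
  qed
  have "A \<le> (?I (\<lambda>x. m x powr (- p)))\<^sup>2 / \<delta> ^ ?d + ?d * \<delta>\<^sup>2 / 2 * (p\<^sup>2 * E)"
    using torus_nash_inequality[OF f(1) _ \<delta>] unfolding A_def E_def sq grad2 by simp
  also have "?d * \<delta>\<^sup>2 / 2 * (p\<^sup>2 * E) \<le> ?d * \<delta>\<^sup>2 / 2 * (p\<^sup>2 * (K * A))"
    using EA by (intro mult_left_mono) auto
  also have "\<dots> = (\<delta> * p * \<kappa>)\<^sup>2 / 2 * A"
    unfolding power_mult_distrib \<kappa>(2) by simp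
  also have "\<dots> = A / 2" using p \<kappa>(1) by (simp add: \<delta>_def)
  finally have "A \<le> 2 * ((?I (\<lambda>x. m x powr (- p)))\<^sup>2 / \<delta> ^ ?d)" by simp
  also have "\<dots> = doubling_const ?d K * p ^ ?d * (?I (\<lambda>x. m x powr (- p)))\<^sup>2"
    by (simp add: \<delta>_def doubling_const_def \<kappa>_def[symmetric] power_divide power_mult_distrib)
  finally show ?thesis unfolding A_def .
qed

definition mean_const :: "real \<Rightarrow> real" where
  "mean_const K = (2 * K + 1) + (2 * K + 1) ^ 3"

text \<open>The starting point of the iteration. For \<open>p = 1\<close> the energy estimate contains
  \<open>\<integral> w\<^sup>3 \<le> 2 K \<integral> w\<^sup>2\<close> with \<open>w = 1 / m\<close>, and the polynomial \<open>w\<^sup>3 - 2 K w\<^sup>2 - w\<close> is bounded below on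
  \<open>w \<ge> 0\<close>.\<close>

lemma mean_reciprocal_bound:
  fixes u m :: "real^'n \<Rightarrow> real"
  assumes \<alpha>: "0 \<le> \<alpha>" "\<alpha> < 1"
    and V: "potential_assms V" and b: "drift_assms b" and sol: "classical_solution \<alpha> V b u m"
  defines "\<beta> \<equiv> sup_norm_on UNIV b" and "\<nu> \<equiv> sup_norm_on (UNIV \<times> {0<..}) V"
  defines "K \<equiv> energy_const \<alpha> \<beta> \<nu>"
  shows "(\<integral>x. m x powr (- 1) \<partial>torus_measure) \<le> mean_const K"
proof -
  interpret T: prob_space "torus_measure :: (real^'n) measure" by (rule prob_space_torus)
  let ?I = "\<lambda>g. \<integral>x. g x \<partial>(torus_measure :: (real^'n) measure)"
  note pos = classical_solution_regularity(1)[OF sol]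
  have "torus_C1 m" by (rule classical_solution_regularity(3)[OF sol])
  then have int: "integrable torus_measure (\<lambda>x. m x powr r)" for r
    by (intro torus_C0_integrable torus_C0_powr pos torus_C1_C0)
  have K: "1 \<le> K" unfolding K_def by (rule energy_const_ge_1)
  define E where "E = ?I (\<lambda>x. m x powr (- 2 * 1 - 2) * (norm (grad m x))\<^sup>2)"
  have "0 \<le> E" unfolding E_def by (intro Bochner_Integration.integral_nonneg) simp
  moreover have "?I (\<lambda>x. m x powr (- 3)) / 2 + 3 / 2 * E \<le> K * ?I (\<lambda>x. m x powr (- 2))"
    using energy_estimate[OF \<alpha> V b sol, of 1, folded \<beta>_def \<nu>_def, folded K_def E_def] by simp
  ultimately have bound: "?I (\<lambda>x. m x powr (- 3)) - 2 * K * ?I (\<lambda>x. m x powr (- 2)) \<le> 0"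
    by linarith
  have poly: "w \<le> w ^ 3 - 2 * K * w\<^sup>2 + mean_const K" if "0 \<le> w" for w :: real
  proof (cases "2 * K + 1 \<le> w")
    case True
    then have "w * 1 \<le> w * w" "w\<^sup>2 * 1 \<le> w\<^sup>2 * (w - 2 * K)"
      using K by (intro mult_left_mono; simp)+
    then have "w \<le> w ^ 3 - 2 * K * w\<^sup>2"
      by (simp add: power2_eq_square power3_eq_cube algebra_simps)
    moreover have "0 \<le> mean_const K" using K by (simp add: mean_const_def)
    ultimately show ?thesis by linarith
  next
    case False
    then have "w\<^sup>2 \<le> (2 * K + 1)\<^sup>2" using that by (intro power_mono) auto
    then have "2 * K * w\<^sup>2 \<le> (2 * K + 1) * (2 * K + 1)\<^sup>2" using K by (intro mult_mono) auto
    then have "2 * K * w\<^sup>2 \<le> (2 * K + 1) ^ 3" by (simp add: power2_eq_square power3_eq_cube mult.assoc)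
    moreover have "0 \<le> w ^ 3" using that by simp
    ultimately show ?thesis using False unfolding mean_const_def by linarith
  qed
  have "?I (\<lambda>x. m x powr (- 1)) \<le> ?I (\<lambda>x. m x powr (- 3) - 2 * K * m x powr (- 2) + mean_const K)"
  proof (rule integral_mono)
    fix x
    have "(m x powr (- 1)) ^ 3 = m x powr (- 3)" "(m x powr (- 1))\<^sup>2 = m x powr (- 2)"
      using pos[of x] by (simp_all add: powr_minus power_inverse)
    then show "m x powr (- 1) \<le> m x powr (- 3) - 2 * K * m x powr (- 2) + mean_const K"
      using poly[of "m x powr (- 1)"] by simp
  qed (intro Bochner_Integration.integrable_add Bochner_Integration.integrable_diff
      integrable_mult_right T.integrable_const int)+
  also have "\<dots> = ?I (\<lambda>x. m x powr (- 3)) - 2 * K * ?I (\<lambda>x. m x powr (- 2)) + mean_const K"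
    using int T.prob_space by simp
  also have "\<dots> \<le> mean_const K" using bound by simp
  finally show ?thesis .
qed

text \<open>The sequence \<open>c\<^sub>j = L 2\<^bsup>d (j + 1)\<^esup> a\<^sub>j\<close> satisfies \<open>c\<^sub>j\<^sub>+\<^sub>1 \<le> c\<^sub>j\<^sup>2\<close>; the weight
  \<open>2\<^bsup>d (j + 1)\<^esup>\<close> is the one that absorbs the growing factor \<open>2\<^bsup>j d\<^esup>\<close>.\<close>

lemma doubling_recursion:
  fixes a :: "nat \<Rightarrow> real"
  assumes L: "1 \<le> L" and nonneg: "\<And>j. 0 \<le> a j"
    and step: "\<And>j. a (Suc j) \<le> L * (2 ^ j) ^ d * (a j)\<^sup>2"
  shows "a j \<le> (L * 2 ^ d * a 0) ^ (2 ^ j)"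
proof -
  let ?c = "\<lambda>j. L * 2 ^ (d * Suc j) * a j"
  have "?c j \<le> (L * 2 ^ d * a 0) ^ (2 ^ j)"
  proof (induction j)
    case (Suc j)
    have "?c (Suc j) \<le> L * 2 ^ (d * Suc (Suc j)) * (L * (2 ^ j) ^ d * (a j)\<^sup>2)"
      using L by (intro mult_left_mono step) auto
    also have "\<dots> = (?c j)\<^sup>2"
      by (simp add: power2_eq_square power_add mult.assoc mult.left_commute flip: power_mult)
    also have "\<dots> \<le> ((L * 2 ^ d * a 0) ^ (2 ^ j))\<^sup>2"
      using Suc.IH L nonneg[of j] by (intro power_mono) auto
    finally show ?case by (simp add: mult.commute flip: power_mult)
  qed simp
  moreover have "1 * a j \<le> L * 2 ^ (d * Suc j) * a j"
  proof (rule mult_right_mono[OF _ nonneg])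
    have "1 * 1 \<le> L * 2 ^ (d * Suc j)" using L by (intro mult_mono) auto
    then show "1 \<le> L * 2 ^ (d * Suc j)" by simp
  qed
  ultimately show ?thesis by simp
qed

text \<open>Markov's inequality for the powers \<open>2\<^sup>j\<close> shows that \<open>{f > 2 B}\<close> has measure at most
  \<open>(1 / 2) ^ (2 ^ j)\<close>. The factor 2 is not optimal, but it makes this bound tend to zero directly.\<close>

lemma (in finite_measure) AE_le_of_dyadic_moments:
  fixes f :: "'a \<Rightarrow> real"
  assumes int: "\<And>j. integrable M (\<lambda>x. f x ^ (2 ^ j))" and nonneg: "\<And>x. 0 \<le> f x"
    and B: "0 < B" and moments: "\<And>j. (\<integral>x. f x ^ (2 ^ j) \<partial>M) \<le> B ^ (2 ^ j)"
  shows "AE x in M. f x \<le> 2 * B"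
proof -
  have [measurable]: "f \<in> borel_measurable M"
    using int[of 0] by (simp add: borel_measurable_integrable)
  let ?S = "{x \<in> space M. \<not> f x \<le> 2 * B}"
  have "measure M ?S \<le> (1 / 2) ^ j" for j
  proof -
    have "(2 * B) ^ (2 ^ j) * measure M ?S = (\<integral>x. (2 * B) ^ (2 ^ j) * indicator ?S x \<partial>M)"
      by simp
    also have "\<dots> \<le> (\<integral>x. f x ^ (2 ^ j) \<partial>M)"
    proof (rule integral_mono)
      fix x assume "x \<in> space M"
      show "(2 * B) ^ (2 ^ j) * indicator ?S x \<le> f x ^ (2 ^ j)"
      proof (cases "x \<in> ?S")
        case True
        then have "(2 * B) ^ (2 ^ j) \<le> f x ^ (2 ^ j)" using B by (intro power_mono) auto
        then show ?thesis using True by simp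
      qed (simp add: nonneg)
    next
      have "integrable M (indicator ?S :: _ \<Rightarrow> real)"
        by (intro integrable_real_indicator) (simp_all add: less_top[symmetric])
      then show "integrable M (\<lambda>x. (2 * B) ^ (2 ^ j) * indicator ?S x)"
        by (rule integrable_mult_right)
    qed (rule int)
    also have "\<dots> \<le> B ^ (2 ^ j)" by (rule moments)
    finally have "2 ^ (2 ^ j) * measure M ?S * B ^ (2 ^ j) \<le> 1 * B ^ (2 ^ j)"
      by (simp add: power_mult_distrib mult.commute mult.left_commute)
    then have *: "2 ^ (2 ^ j) * measure M ?S \<le> 1" using B by (subst (asm) mult_le_cancel_right) auto
    have "(2::real) ^ j * measure M ?S \<le> 2 ^ (2 ^ j) * measure M ?S"
      by (intro mult_right_mono power_increasing) (auto simp: less_imp_le)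
    with * have "2 ^ j * measure M ?S \<le> 1" by simp
    then show ?thesis by (simp add: field_simps power_divide)
  qed
  moreover have "(\<lambda>j. (1 / 2 :: real) ^ j) \<longlonglongrightarrow> 0" by (rule LIMSEQ_realpow_zero) auto
  ultimately have "measure M ?S \<le> 0" by (intro LIMSEQ_le_const) auto
  then have "emeasure M ?S = 0" by (simp add: emeasure_eq_measure measure_le_0_iff)
  then show ?thesis by (subst AE_iff_measurable[OF _ refl]) auto
qed

theorem proposition2p2:
  fixes \<alpha> :: real
  assumes "0 \<le> \<alpha>" and "\<alpha> < 1"
  shows "\<exists>C :: real \<Rightarrow> real \<Rightarrow> real.
    (\<forall>\<beta> \<nu>. 0 \<le> C \<beta> \<nu>) \<and>
    (\<forall>(V :: (real^'n) \<times> real \<Rightarrow> real) (b :: real^'n \<Rightarrow> real^'n) u m.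
       potential_assms V \<longrightarrow> drift_assms b \<longrightarrow> classical_solution \<alpha> V b u m \<longrightarrow>
       Linfty_norm_torus (\<lambda>x. 1 / m x)
         \<le> ereal (C (sup_norm_on UNIV b) (sup_norm_on (UNIV \<times> {0<..}) V)))"
proof -
  define K where "K = energy_const \<alpha>"
  define B where "B = (\<lambda>\<beta> \<nu>. doubling_const CARD('n) (K \<beta> \<nu>) * 2 ^ CARD('n) * mean_const (K \<beta> \<nu>))"
  have K1: "1 \<le> K \<beta> \<nu>" for \<beta> \<nu> unfolding K_def by (rule energy_const_ge_1)
  have L1: "1 \<le> doubling_const CARD('n) (K \<beta> \<nu>)" for \<beta> \<nu>
  proof -
    have "1 * 1 \<le> CARD('n) * K \<beta> \<nu>" using K1 by (intro mult_mono) (auto simp: Suc_le_eq)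
    then have "1 \<le> sqrt (CARD('n) * K \<beta> \<nu>) ^ CARD('n)" by (intro one_le_power) simp
    then show ?thesis by (simp add: doubling_const_def)
  qed
  have B0: "0 < B \<beta> \<nu>" for \<beta> \<nu>
  proof -
    have "0 < mean_const (K \<beta> \<nu>)" using K1[of \<beta> \<nu>] by (simp add: mean_const_def add_pos_pos)
    then show ?thesis using L1[of \<beta> \<nu>] by (simp add: B_def)
  qed
  show ?thesis
  proof (intro exI[of _ "\<lambda>\<beta> \<nu>. 2 * B \<beta> \<nu>"] conjI allI impI)
    show "0 \<le> 2 * B \<beta> \<nu>" for \<beta> \<nu> using B0[of \<beta> \<nu>] by simp
    fix V :: "(real^'n) \<times> real \<Rightarrow> real" and b :: "real^'n \<Rightarrow> real^'n" and u m :: "real^'n \<Rightarrow> real"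
    assume V: "potential_assms V" and b: "drift_assms b" and sol: "classical_solution \<alpha> V b u m"
    interpret T: prob_space "torus_measure :: (real^'n) measure" by (rule prob_space_torus)
    let ?\<beta> = "sup_norm_on UNIV b" and ?\<nu> = "sup_norm_on (UNIV \<times> {0<..}) V"
    let ?I = "\<lambda>g. \<integral>x. g x \<partial>(torus_measure :: (real^'n) measure)"
    note pos = classical_solution_regularity(1)[OF sol]
    have m1: "torus_C1 m" by (rule classical_solution_regularity(3)[OF sol])
    then have int: "integrable torus_measure (\<lambda>x. m x powr r)" for r
      by (intro torus_C0_integrable torus_C0_powr pos torus_C1_C0)
    define a where "a = (\<lambda>j :: nat. ?I (\<lambda>x. m x powr (- (2 ^ j))))"
    have w: "(1 / m x) ^ (2 ^ j) = m x powr (- (2 ^ j))" for x j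
      using pos[of x] powr_realpow[of "m x" "2 ^ j"] by (simp add: powr_minus_divide power_one_over)
    have a0: "0 \<le> a j" for j unfolding a_def by (intro Bochner_Integration.integral_nonneg) simp
    have "a j \<le> (doubling_const CARD('n) (K ?\<beta> ?\<nu>) * 2 ^ CARD('n) * a 0) ^ (2 ^ j)" for j
    proof (rule doubling_recursion[OF L1 a0])
      show "a (Suc j) \<le> doubling_const CARD('n) (K ?\<beta> ?\<nu>) * (2 ^ j) ^ CARD('n) * (a j)\<^sup>2" for j
        using moment_doubling[OF assms V b sol, of "2 ^ j"] by (simp add: a_def K_def)
    qed
    also have "(doubling_const CARD('n) (K ?\<beta> ?\<nu>) * 2 ^ CARD('n) * a 0) ^ (2 ^ j) \<le> B ?\<beta> ?\<nu> ^ (2 ^ j)" for j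
      unfolding B_def
      using mean_reciprocal_bound[OF assms V b sol] L1[of ?\<beta> ?\<nu>] a0[of 0]
      by (intro power_mono mult_left_mono) (auto simp: a_def K_def)
    finally have a: "a j \<le> B ?\<beta> ?\<nu> ^ (2 ^ j)" for j .
    have "AE x in torus_measure. 1 / m x \<le> 2 * B ?\<beta> ?\<nu>"
    proof (rule T.AE_le_of_dyadic_moments[OF _ _ B0])
      show "integrable torus_measure (\<lambda>x. (1 / m x) ^ 2 ^ j)" for j unfolding w by (rule int)
      show "0 \<le> 1 / m x" for x using pos[of x] by simp
      show "?I (\<lambda>x. (1 / m x) ^ 2 ^ j) \<le> B ?\<beta> ?\<nu> ^ 2 ^ j" for j
        unfolding w using a[of j] by (simp add: a_def)
    qed
    then have "AE x in torus_measure. ereal \<bar>1 / m x\<bar> \<le> ereal (2 * B ?\<beta> ?\<nu>)"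
      by eventually_elim (use pos in \<open>simp add: less_imp_le\<close>)
    moreover have "(\<lambda>x. ereal \<bar>1 / m x\<bar>) \<in> borel_measurable torus_measure"
      using borel_measurable_integrable[OF int[of "- 1"]] pos by (simp add: powr_minus_divide)
    ultimately show "Linfty_norm_torus (\<lambda>x. 1 / m x) \<le> ereal (2 * B ?\<beta> ?\<nu>)"
      unfolding Linfty_norm_torus_def by (intro esssup_I)
  qed
qed

end
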